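(* Let $G$ be an amenable locally compact second countable group with left Haar measure $\lambda$, and let $(X,\mu)$ be a nonsingular probability $G$-space. Then for every countable family $\mathcal{L}\subset L^1(X,\mu)$ there exists a Følner sequence $S_1\subseteq S_2\subseteq\cdots$ of $G$ such that for every $f\in\mathcal{L}$, $$\lim_{n\to\infty}\frac{\int_{S_n}\frac{d\mu\circ g}{d\mu}(x)\,f(g.x)\,d\lambda(g)}{\int_{S_n}\frac{d\mu\circ g}{d\mu}(x)\,d\lambda(g)}=\mathbb{E}\left(f\mid\mathrm{Inv}_G(X)\right)(x)$$ both for $\mu$-a.e. $x$ and in $L^1(X,\mu)$.
   Context: A locally compact second countable (lcsc) group is a Polish group whose topology is locally compact. A Borel $G$-space is a standard Borel space $X$ with a Borel map $G\times X\to X$, $(g,x)\mapsto g.x$, such that $e.x=x$ and $gh.x=g.(h.x)$. A nonsingular probability $G$-space $(X,\mu)$ is a Borel $G$-space with a Borel probability measure $\mu$ such that $\mu\circ g^{-1}$ and $\mu$ are mutually absolutely continuous for every $g\in G$. Here $\frac{d\mu\circ g}{d\mu}(x)$ stands for a fixed Radon–Nikodym cocycle $\nabla_g(x)$: a Borel function $\nabla:G\times X\to\mathbb{R}_{>0}$ with $\nabla_{gh}(x)=\nabla_g(h.x)\nabla_h(x)$ for all $g,h,x$ and $\nabla_g=\frac{d\mu\circ g}{d\mu}$ $\mu$-a.e. for each $g$, where $\mu\circ g$ is the measure $A\mapsto\mu(g.A)$ (such a version exists by the Mackey Cocycle Theorem). $\mathrm{Inv}_G(X)$ is the $\sigma$-algebra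 of $G$-invariant Borel subsets of $X$. For a compact set $K\subset G$ and $\epsilon>0$, a compact set $S\subset G$ is $[K,\epsilon]$-invariant if $\lambda(\{g\in S:Kg\subseteq S\})>(1-\epsilon)\lambda(S)$. A Følner sequence of $G$ is a sequence of compact sets $S_1\subseteq S_2\subseteq\cdots$ with $\bigcup_nS_n=G$ such that for every compact $K\subset G$ and $\epsilon>0$, $S_n$ is $[K,\epsilon]$-invariant for all sufficiently large $n$. $G$ is amenable if it admits a Følner sequence. *)

theory Defs
  imports "HOL-Probability.Probability"
begin

text \<open>
  A (not necessarily commutative) Polish group is a type of sort
  \<open>{polish_space, topological_group_add}\<close>. The library's classes for noncommutative
  topological groups are additive, so the product \<open>gh\<close> is written \<open>g + h\<close>, the
  identity \<open>e\<close> is \<open>0\<close> and \<open>g\<^sup>-\<^sup>1\<close> is \<open>- g\<close>; no commutativity is assumed.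
\<close>

text \<open>
  Regularity is not required in the next definition: on a locally compact second countable
  space every Borel measure that is finite on compact sets is regular.
\<close>

definition left_haar_measure :: "'g::{polish_space,topological_group_add} measure \<Rightarrow> bool" where
  "left_haar_measure L \<longleftrightarrow>
     sets L = sets borel \<and>
     emeasure L UNIV \<noteq> 0 \<and>
     (\<forall>K. compact K \<longrightarrow> emeasure L K < \<infinity>) \<and>
     (\<forall>g. \<forall>A\<in>sets borel. emeasure L ((\<lambda>h. g + h) ` A) = emeasure L A)"

definition invariant_compact ::
  "'g::{polish_space,topological_group_add} measure \<Rightarrow> 'g set \<Rightarrow> real \<Rightarrow> 'g set \<Rightarrow> bool" where
  "invariant_compact L K \<epsilon> S \<longleftrightarrow>
     compact S \<and>
     measure L {g \<in> S. (\<lambda>k. k + g) ` K \<subseteq> S} > (1 - \<epsilon>) * measure L S"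

definition folner_sequence ::
  "'g::{polish_space,topological_group_add} measure \<Rightarrow> (nat \<Rightarrow> 'g set) \<Rightarrow> bool" where
  "folner_sequence L S \<longleftrightarrow>
     (\<forall>n. compact (S n)) \<and> incseq S \<and> (\<Union>n. S n) = UNIV \<and>
     (\<forall>K \<epsilon>. compact K \<and> \<epsilon> > 0 \<longrightarrow> (\<forall>\<^sub>F n in sequentially. invariant_compact L K \<epsilon> (S n)))"

text \<open>
  The parameter \<open>L\<close> is the left Haar measure; being unique up to a positive factor, it does
  not affect which groups are amenable.
\<close>

definition amenable :: "'g::{polish_space,topological_group_add} measure \<Rightarrow> bool" where
  "amenable L \<longleftrightarrow> (\<exists>S. folner_sequence L S)"

definition standard_borel :: "'x measure \<Rightarrow> bool" where
  "standard_borel M \<longleftrightarrow>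
     (\<exists>T. completely_metrizable_space T \<and> second_countable T \<and> topspace T = space M \<and>
          sets M = sigma_sets (topspace T) {U. openin T U})"

definition borel_G_space ::
  "('g::{polish_space,topological_group_add} \<Rightarrow> 'x \<Rightarrow> 'x) \<Rightarrow> 'x measure \<Rightarrow> bool" where
  "borel_G_space act M \<longleftrightarrow>
     standard_borel M \<and>
     (\<lambda>(g, x). act g x) \<in> measurable (borel \<Otimes>\<^sub>M M) M \<and>
     (\<forall>x\<in>space M. act 0 x = x) \<and>
     (\<forall>g h. \<forall>x\<in>space M. act (g + h) x = act g (act h x))"

definition nonsingular_probability_G_space ::
  "('g::{polish_space,topological_group_add} \<Rightarrow> 'x \<Rightarrow> 'x) \<Rightarrow> 'x measure \<Rightarrow> bool" where
  "nonsingular_probability_G_space act M \<longleftrightarrow>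
     borel_G_space act M \<and> prob_space M \<and>
     (\<forall>g. absolutely_continuous M (distr M M (act g)) \<and>
          absolutely_continuous (distr M M (act g)) M)"

text \<open>
  The measure \<open>A \<mapsto> \<mu>(g.A)\<close> is encoded as the push-forward along the inverse of \<open>g\<close>,
  see \<open>emeasure_distr_act_uminus\<close> below.
\<close>

definition RN_cocycle ::
  "('g::{polish_space,topological_group_add} \<Rightarrow> 'x \<Rightarrow> 'x) \<Rightarrow> 'x measure \<Rightarrow>
   ('g \<Rightarrow> 'x \<Rightarrow> real) \<Rightarrow> bool" where
  "RN_cocycle act M D \<longleftrightarrow>
     (\<lambda>(g, x). D g x) \<in> borel_measurable (borel \<Otimes>\<^sub>M M) \<and>
     (\<forall>g. \<forall>x\<in>space M. D g x > 0) \<and>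
     (\<forall>g h. \<forall>x\<in>space M. D (g + h) x = D g (act h x) * D h x) \<and>
     (\<forall>g. AE x in M. ennreal (D g x) = RN_deriv M (distr M M (act (- g))) x)"

definition Inv_algebra :: "('g \<Rightarrow> 'x \<Rightarrow> 'x) \<Rightarrow> 'x measure \<Rightarrow> 'x measure" where
  "Inv_algebra act M = sigma (space M) {A \<in> sets M. \<forall>g. act g ` A = A}"

definition ratio_average ::
  "'g::{polish_space,topological_group_add} measure \<Rightarrow> ('g \<Rightarrow> 'x \<Rightarrow> 'x) \<Rightarrow> ('g \<Rightarrow> 'x \<Rightarrow> real) \<Rightarrow>
   'g set \<Rightarrow> ('x \<Rightarrow> real) \<Rightarrow> 'x \<Rightarrow> real" where
  "ratio_average L act D S f x = (LINT g:S|L. D g x * f (act g x)) / (LINT g:S|L. D g x)"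

definition tendsto_L1 :: "'x measure \<Rightarrow> (nat \<Rightarrow> 'x \<Rightarrow> real) \<Rightarrow> ('x \<Rightarrow> real) \<Rightarrow> bool" where
  "tendsto_L1 M F h \<longleftrightarrow>
     (\<forall>n. integrable M (F n)) \<and> integrable M h \<and>
     (\<lambda>n. LINT x|M. \<bar>F n x - h x\<bar>) \<longlonglongrightarrow> 0"

lemma borel_G_space_measurable:
  assumes "borel_G_space act M"
  shows "act g \<in> measurable M M"
proof -
  have "(\<lambda>(g, x). act g x) \<in> measurable (borel \<Otimes>\<^sub>M M) M"
    using assms by (simp add: borel_G_space_def)
  from measurable_compose[OF measurable_Pair1' this, of g] show ?thesis by simp
qed

lemma emeasure_distr_act_uminus:
  assumes "borel_G_space act M" "A \<in> sets M"
  shows "emeasure (distr M M (act (- g))) A = emeasure M (act g ` A)"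
proof -
  have meas: "act h \<in> measurable M M" for h
    using assms(1) by (rule borel_G_space_measurable)
  have sp: "act h x \<in> space M" if "x \<in> space M" for h x
    using meas that by (rule measurable_space)
  have id0: "act 0 x = x" if "x \<in> space M" for x
    using assms(1) that by (simp add: borel_G_space_def)
  have cmp: "act h (act k x) = act (h + k) x" if "x \<in> space M" for h k x
    using assms(1) that by (simp add: borel_G_space_def)
  have sub: "x \<in> space M" if "x \<in> A" for x
    using sets.sets_into_space[OF assms(2)] that by blast
  have "act (- g) -` A \<inter> space M = act g ` A"
  proof (intro set_eqI iffI)
    fix x assume x: "x \<in> act (- g) -` A \<inter> space M"
    then have "x = act g (act (- g) x)" by (simp add: cmp id0)
    with x show "x \<in> act g ` A" by blast
  next
    fix x assume "x \<in> act g ` A"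
    then show "x \<in> act (- g) -` A \<inter> space M" by (auto simp: cmp id0 sp sub)
  qed
  then show ?thesis
    using meas assms(2) by (simp add: emeasure_distr)
qed

lemma sets_Inv_algebra:
  assumes "borel_G_space act M"
  shows "sets (Inv_algebra act M) = {A \<in> sets M. \<forall>g. act g ` A = A}"
proof -
  let ?I = "{A \<in> sets M. \<forall>g. act g ` A = A}"
  have sp: "act h x \<in> space M" if "x \<in> space M" for h x
    using borel_G_space_measurable[OF assms] that by (rule measurable_space)
  have id0: "act 0 x = x" if "x \<in> space M" for x
    using assms that by (simp add: borel_G_space_def)
  have cmp: "act h (act k x) = act (h + k) x" if "x \<in> space M" for h k x
    using assms that by (simp add: borel_G_space_def)
  have inv: "act g ` A = A" if A: "A \<subseteq> space M" and *: "\<And>h x. x \<in> A \<Longrightarrow> act h x \<in> A" for g A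
  proof (intro set_eqI iffI)
    fix x assume "x \<in> A"
    then have "x = act g (act (- g) x)" "act (- g) x \<in> A"
      using A * by (auto simp: cmp id0 subsetD)
    then show "x \<in> act g ` A" by blast
  qed (use * in auto)
  have "sigma_algebra (space M) ?I"
  proof (rule sigma_algebra_iff2[THEN iffD2], intro conjI ballI allI impI)
    show "?I \<subseteq> Pow (space M)" using sets.sets_into_space by auto
    show "{} \<in> ?I" by simp
  next
    fix A assume A: "A \<in> ?I"
    have "act g x \<notin> A" if x: "x \<in> space M - A" for g x
    proof
      assume "act g x \<in> A"
      with A have "act (- g) (act g x) \<in> A" by blast
      with x show False by (simp add: cmp id0)
    qed
    then have "act g ` (space M - A) = space M - A" for g
      by (intro inv) (auto simp: sp)
    with A show "space M - A \<in> ?I" by auto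
  next
    fix A :: "nat \<Rightarrow> 'b set" assume "range A \<subseteq> ?I"
    then have A: "A n \<in> sets M" "act g ` A n = A n" for n g by auto
    then have "act g ` (\<Union>n. A n) = (\<Union>n. A n)" for g by (simp add: image_UN)
    with A(1) show "(\<Union>n. A n) \<in> ?I" by auto
  qed
  then show ?thesis
    unfolding Inv_algebra_def using sets.sets_into_space
    by (subst sets_measure_of) (auto simp: sigma_algebra.sigma_sets_eq)
qed

end

theory Submission
  imports Defs
begin

text \<open>
  Write \<open>T\<^sub>k f (x) = D k x * f (k.x)\<close>, an isometry of \<open>L\<^sup>1\<close>. For a Folner set \<open>F\<close> and \<open>h\<close> drawn at
  random from \<open>F\<close>, the ratio average of \<open>f\<close> over the right translate \<open>F - h\<close>, taken at \<open>x\<close>, is the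
  ratio average over \<open>F\<close> taken at \<open>- h.x\<close>, since the modular factor and the cocycle cancel. Hence its
  expected \<open>L\<^sup>1\<close>-norm equals the \<open>L\<^sup>1\<close>-norm of the mean of \<open>T\<^sub>k f\<close> over \<open>k \<in> F\<close>. These means tend to
  \<open>0\<close> for coboundaries \<open>T\<^sub>k f - f\<close>, and coboundaries span a dense subspace of the functions with
  vanishing conditional expectation: a function orthogonal to all of them is invariant. So for
  \<open>f\<close> minus its conditional expectation some translate of a Folner set, containing a prescribed
  compact set, gives a small ratio average. Choosing the translates inductively with errors at
  most \<open>2\<^sup>-\<^sup>m\<close> gives convergence in \<open>L\<^sup>1\<close> and, by summability, almost everywhere.
\<close>

section \<open>Haar measure and translates of Folner sets\<close>

text \<open>No maximal inequality enters. The obstacle is the denominator of the ratio average: it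
  depends on \<open>x\<close>, so an \<open>L\<^sup>1\<close>-bound on the numerator gives none on
  the quotient over a fixed Folner set. Randomising \<open>h\<close> removes it, because the change
  of variables by \<open>h\<close> brings in a weight that integrates to this denominator. Right
  translates are the suitable ones: invariance multiplies by \<open>K\<close> from the left, which
  commutes with right translation. Moreover \<open>C \<subseteq> F - h\<close> says
  \<open>C + h \<subseteq> F\<close>, the condition inside \<open>invariant_compact\<close>, so more
  than half of all \<open>h \<in> F\<close> are admissible and Markov's inequality finds a good one
  among them. The measure is not invariant, yet the limit is the conditional expectation:
  \<open>T\<^sub>k\<close> preserves integrals over invariant sets, and ratio averages reproduce
  invariant functions. Density is obtained from an \<open>L\<^sup>2\<close>-projection along bounded
  functions, so the coboundaries used must be bounded although the cocycle is not.\<close>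

lemma borel_measurable_uminus_group [measurable (raw)]:
  fixes f :: "'a \<Rightarrow> 'b::{second_countable_topology, topological_group_add}"
  assumes [measurable]: "f \<in> borel_measurable N"
  shows "(\<lambda>x. - f x) \<in> borel_measurable N"
proof -
  have "continuous_on UNIV (\<lambda>p::'b. - p)"
    by (intro continuous_intros)
  from borel_measurable_continuous_onI[OF this] assms show ?thesis
    by (rule measurable_compose_rev)
qed

lemma borel_measurable_diff_group [measurable (raw)]:
  fixes f g :: "'a \<Rightarrow> 'b::{second_countable_topology, topological_group_add}"
  assumes [measurable]: "f \<in> borel_measurable N" "g \<in> borel_measurable N"
  shows "(\<lambda>x. f x - g x) \<in> borel_measurable N"
  using borel_measurable_add[OF assms(1) borel_measurable_uminus_group[OF assms(2)]] by simp

lemma vimage_add_right: "(\<lambda>g. g + h) -` A = (\<lambda>g. g - h) ` A" for h :: "'a::group_add"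
proof (intro set_eqI iffI)
  fix x assume "x \<in> (\<lambda>g. g + h) -` A"
  then show "x \<in> (\<lambda>g. g - h) ` A" by (intro image_eqI[of _ _ "x + h"]) auto
qed auto

lemma compact_translate: "compact S \<Longrightarrow> compact ((\<lambda>g. g - h) ` S)" for h :: "'a::topological_group_add"
  unfolding diff_conv_add_uminus
  by (intro compact_continuous_image continuous_intros)

lemma image_left_sets:
  fixes k :: "'a::{second_countable_topology, topological_group_add}"
  assumes "A \<in> sets borel"
  shows "(\<lambda>g. k + g) ` A \<in> sets borel"
proof -
  have "(\<lambda>g. k + g) ` A = (\<lambda>g. - k + g) -` A"
    by (force simp: image_iff add.assoc[symmetric])
  moreover have "(\<lambda>g. - k + g) -` A \<in> sets borel"
    using assms measurable_sets[of "\<lambda>g. - k + g" borel borel A] by simp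
  ultimately show ?thesis by simp
qed

text \<open>An intersection of closed preimages, for arbitrary \<open>K\<close>. Hence the set in
  \<open>invariant_compact\<close> is Borel and its \<open>measure\<close> is not a default
  value.\<close>

lemma invariant_part_closed:
  fixes S :: "'a::topological_group_add set"
  assumes "closed S"
  shows "closed {g \<in> S. (\<lambda>k. k + g) ` K \<subseteq> S}"
proof -
  have "{g \<in> S. (\<lambda>k. k + g) ` K \<subseteq> S} = S \<inter> (\<Inter>k\<in>K. (\<lambda>g. k + g) -` S)"
    by auto
  moreover have "closed ((\<lambda>g. k + g) -` S)" for k
    by (intro closed_vimage assms continuous_intros)
  ultimately show ?thesis using assms by (simp add: closed_INT closed_Int)
qed

lemma measure_Diff_Int:
  assumes "A \<in> fmeasurable M" "B \<in> sets M"
  shows "measure M (A - B) = measure M A - measure M (A \<inter> B)"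
  using assms fmeasurable_Int_fmeasurable[OF assms]
  by (subst measure_Diff[symmetric]) (auto simp: fmeasurable_def Diff_Int)

locale amenable_haar =
  fixes L :: "'g::{polish_space,topological_group_add} measure" and F :: "nat \<Rightarrow> 'g set"
  assumes haar: "left_haar_measure L" and folner: "folner_sequence L F"
begin

lemma sets_L [measurable_cong, simp]: "sets L = sets borel"
  using haar by (simp add: left_haar_measure_def)

lemma space_L [simp]: "space L = UNIV"
  using sets_eq_imp_space_eq[OF sets_L] by simp

lemma compact_F: "compact (F n)" and UN_F: "(\<Union>n. F n) = UNIV"
  and F_invariant: "compact K \<Longrightarrow> 0 < \<epsilon> \<Longrightarrow> \<forall>\<^sub>F n in sequentially. invariant_compact L K \<epsilon> (F n)"
  using folner by (auto simp: folner_sequence_def)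

lemma F_sets [measurable]: "F n \<in> sets borel"
  by (rule borel_compact[OF compact_F])

lemma emeasure_compact: "compact K \<Longrightarrow> emeasure L K < \<infinity>"
  using haar by (simp add: left_haar_measure_def)

sublocale sigma_finite_measure L
proof
  show "\<exists>A. countable A \<and> A \<subseteq> sets L \<and> \<Union>A = space L \<and> (\<forall>a\<in>A. emeasure L a \<noteq> \<infinity>)"
    using UN_F emeasure_compact[OF compact_F] by (intro exI[of _ "range F"]) (auto simp: less_top)
qed

sublocale LL: pair_sigma_finite L L ..

lemma emeasure_L_UNIV: "emeasure L UNIV \<noteq> 0"
  using haar by (simp add: left_haar_measure_def)

section \<open>Null sets of Haar measure under translation and inversion\<close>

lemma distr_left: "distr L L (\<lambda>h. g + h) = L"
proof (rule measure_eqI)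
  fix A assume "A \<in> sets (distr L L (\<lambda>h. g + h))"
  then have [measurable]: "A \<in> sets borel" by simp
  have "(\<lambda>h. g + h) -` A \<inter> space L = (\<lambda>h. - g + h) ` A"
    by (force simp: image_iff add.assoc[symmetric])
  then have "emeasure (distr L L (\<lambda>h. g + h)) A = emeasure L ((\<lambda>h. - g + h) ` A)"
    by (subst emeasure_distr) auto
  also have "\<dots> = emeasure L A"
    using haar by (simp add: left_haar_measure_def)
  finally show "emeasure (distr L L (\<lambda>h. g + h)) A = emeasure L A" .
qed simp

lemma AE_left:
  assumes [measurable]: "Measurable.pred borel P" and P: "AE h in L. P h"
  shows "AE h in L. P (g + h)"
proof -
  have "AE h in distr L L (\<lambda>h. g + h). P h"
    using P unfolding distr_left .
  then show ?thesis by (subst (asm) AE_distr_iff) auto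
qed

lemma AE_const_L: "(AE g in L. c) \<longleftrightarrow> c"
proof
  assume "AE g in L. c"
  then show c
    by (rule contrapos_pp) (use emeasure_L_UNIV in \<open>auto simp: AE_iff_measurable[OF _ refl]\<close>)
qed simp

lemma AE_obtain:
  assumes "AE g in L. P g"
  obtains g where "P g"
proof -
  have "\<exists>g. P g"
  proof (rule ccontr)
    assume "\<nexists>g. P g"
    then have "AE g in L. False" using assms by simp
    then show False using AE_const_L by simp
  qed
  then show thesis using that by blast
qed

text \<open>Fubini: for almost all \<open>x\<close>, almost every \<open>y\<close> satisfies \<open>P (- y + x)\<close>; one such \<open>x\<close>
  suffices, by left invariance.\<close>

lemma AE_uminus:
  assumes [measurable]: "Measurable.pred borel P" and P: "AE h in L. P h"
  shows "AE h in L. P (- h)"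
proof -
  have "AE y in L. AE x in L. P (- y + x)"
    using AE_left[OF assms] by simp
  then have "AE x in L. AE y in L. P (- y + x)"
    by (subst LL.AE_commute) measurable
  then obtain x where "AE y in L. P (- y + x)"
    by (rule AE_obtain)
  then have "AE y in L. P (- (x + y) + x)"
    by (rule AE_left[rotated]) measurable
  then show ?thesis by (simp add: minus_add add.assoc)
qed

text \<open>Inversion conjugates right translations into left ones. Only null sets are transferred,
  since \<open>L\<close> need not be right invariant.\<close>

lemma AE_right:
  assumes [measurable]: "Measurable.pred borel P" and P: "AE h in L. P h"
  shows "AE h in L. P (h + g)"
proof -
  have "AE h in L. P (- (- g + h))"
    by (rule AE_left[OF _ AE_uminus[OF assms]]) measurable
  then have "AE h in L. P (- h + g)" by (simp add: minus_add)
  then have "AE h in L. P (- (- h) + g)"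
    by (rule AE_uminus[rotated]) measurable
  then show ?thesis by simp
qed

text \<open>The density of a right translate of \<open>L\<close> is invariant, hence almost everywhere constant.\<close>

lemma right_translate_density:
  obtains c where "0 < c" "distr L L (\<lambda>g. g + h) = density L (\<lambda>_. ennreal c)"
proof -
  let ?N = "distr L L (\<lambda>g. g + h)"
  have ac: "absolutely_continuous L ?N"
    unfolding absolutely_continuous_def
  proof
    fix A assume A: "A \<in> null_sets L"
    then have [measurable]: "A \<in> sets borel" by auto
    have "AE g in L. g \<notin> A"
      using A by (simp add: AE_iff_null_sets[symmetric])
    then have "AE g in L. g + h \<notin> A"
      by (rule AE_right[rotated]) measurable
    then have "AE g in ?N. g \<notin> A"
      by (subst AE_distr_iff) auto
    then show "A \<in> null_sets ?N"
      by (simp add: AE_iff_null_sets)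
  qed
  define \<rho> where "\<rho> = RN_deriv L ?N"
  have [measurable]: "\<rho> \<in> borel_measurable borel"
    using borel_measurable_RN_deriv[of L ?N] by (simp add: \<rho>_def)
  have \<rho>: "density L \<rho> = ?N"
    unfolding \<rho>_def by (rule density_RN_deriv[OF ac]) simp
  \<comment> \<open>Left translations commute with the right translation by \<open>h\<close>, so
    \<open>?N\<close> is left invariant like \<open>L\<close>. Then \<open>\<rho>\<close> and its
    left translate are densities of the same measure.\<close>
  have inv: "AE x in L. \<rho> (g + x) = \<rho> x" for g
  proof -
    have "distr (density L (\<lambda>x. \<rho> (g + x))) L (\<lambda>x. g + x) = density (distr L L (\<lambda>x. g + x)) \<rho>"
      by (subst density_distr) auto
    also have "\<dots> = ?N" by (simp add: distr_left \<rho>)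
    finally have 1: "distr (density L (\<lambda>x. \<rho> (g + x))) L (\<lambda>x. g + x) = ?N" .
    have "density L (\<lambda>x. \<rho> (g + x)) =
        distr (distr (density L (\<lambda>x. \<rho> (g + x))) L (\<lambda>x. g + x)) L (\<lambda>x. - g + x)"
      by (subst distr_distr) (auto simp: comp_def add.assoc[symmetric] intro!: distr_id2[symmetric])
    also have "\<dots> = distr ?N L (\<lambda>x. - g + x)" by (simp add: 1)
    also have "\<dots> = distr (distr L L (\<lambda>x. - g + x)) L (\<lambda>x. x + h)"
      by (simp add: distr_distr comp_def add.assoc)
    also have "\<dots> = density L \<rho>" by (simp add: distr_left \<rho>)
    finally show ?thesis
      by (subst (asm) density_unique_iff) auto
  qed
  \<comment> \<open>The exceptional null set depends on \<open>g\<close>. Fubini provides a single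
    \<open>x\<close> that works for almost every \<open>g\<close>, and right translation by
    \<open>- x\<close> then removes it from the argument.\<close>
  then have "AE g in L. AE x in L. \<rho> (g + x) = \<rho> x" by simp
  then have "AE x in L. AE g in L. \<rho> (g + x) = \<rho> x"
    by (subst LL.AE_commute) measurable
  then obtain x where "AE g in L. \<rho> (g + x) = \<rho> x"
    by (rule AE_obtain)
  then have "AE g in L. \<rho> ((g + - x) + x) = \<rho> x"
    by (rule AE_right[rotated]) measurable
  then have "AE g in L. \<rho> g = \<rho> x" by (simp add: add.assoc)
  then have "density L \<rho> = density L (\<lambda>_. \<rho> x)"
    by (intro density_cong) auto
  then have N: "?N = density L (\<lambda>_. \<rho> x)" using \<rho> by simp
  have "\<rho> x \<noteq> 0"
  proof
    assume "\<rho> x = 0"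
    have "emeasure ?N UNIV = emeasure L UNIV"
      by (subst emeasure_distr) auto
    with \<open>\<rho> x = 0\<close> N show False using emeasure_L_UNIV by (simp add: emeasure_density)
  qed
  \<comment> \<open>An infinite density would give infinite measure to a right translate of some
    \<open>F n\<close> of positive measure, which is compact.\<close>
  moreover have "\<rho> x \<noteq> \<infinity>"
  proof
    assume inf: "\<rho> x = \<infinity>"
    obtain n where "emeasure L (F n) \<noteq> 0"
      using emeasure_L_UNIV UN_F emeasure_UN_eq_0[of L F] by (metis F_sets image_subsetI sets_L)
    with inf have "emeasure ?N (F n) = \<infinity>"
      by (subst N) (simp add: emeasure_density_const ennreal_top_mult)
    moreover have "emeasure ?N (F n) = emeasure L ((\<lambda>g. g - h) ` F n)"
      by (subst emeasure_distr) (auto simp: vimage_add_right)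
    moreover have "compact ((\<lambda>g. g - h) ` F n)"
      by (intro compact_translate compact_F)
    ultimately show False using emeasure_compact by fastforce
  qed
  ultimately have "0 < enn2real (\<rho> x)" "?N = density L (\<lambda>_. ennreal (enn2real (\<rho> x)))"
    using N by (auto simp: enn2real_positive_iff less_top ennreal_enn2real_if zero_less_iff_neq_zero)
  then show thesis by (rule that)
qed

text \<open>\<open>c\<close> is the value of the modular function belonging to \<open>h\<close>; one
  \<open>c\<close> serves all \<open>A\<close> and \<open>u\<close>, so it cancels in quotients. The
  integral formula needs no integrability: both sides are 0 by default in the same cases.\<close>

lemma right_translate_scaling:
  obtains c where "0 < c"
    "\<And>A. A \<in> sets borel \<Longrightarrow> measure L ((\<lambda>g. g - h) ` A) = c * measure L A"
    "\<And>A u. A \<in> sets borel \<Longrightarrow> u \<in> borel_measurable borel \<Longrightarrow>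
      (LINT g:((\<lambda>g. g - h) ` A)|L. u g) = c * (LINT g:A|L. u (g - h) :: real)"
proof -
  obtain c where c: "0 < c" and dens: "distr L L (\<lambda>g. g + h) = density L (\<lambda>_. ennreal c)"
    by (rule right_translate_density)
  show thesis
  proof
    fix A :: "'g set" assume A [measurable]: "A \<in> sets borel"
    have "measure L ((\<lambda>g. g - h) ` A) = measure (distr L L (\<lambda>g. g + h)) A"
      by (subst measure_distr) (auto simp: vimage_add_right)
    also have "\<dots> = c * measure L A"
      using c by (simp add: dens measure_def emeasure_density_const enn2real_mult)
    finally show "measure L ((\<lambda>g. g - h) ` A) = c * measure L A" .
    fix u :: "'g \<Rightarrow> real" assume [measurable]: "u \<in> borel_measurable borel"
    have ind: "indicator ((\<lambda>g. g - h) ` A) g = (indicator A (g + h) :: real)" for g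
      unfolding vimage_add_right[symmetric] by (simp split: split_indicator)
    have "(LINT g:((\<lambda>g. g - h) ` A)|L. u g) = (LINT g|L. indicator A (g + h) * u ((g + h) - h))"
      by (simp add: set_lebesgue_integral_def ind)
    also have "\<dots> = (LINT g|distr L L (\<lambda>g. g + h). indicator A g * u (g - h))"
      by (subst integral_distr) auto
    also have "\<dots> = c * (LINT g:A|L. u (g - h))"
      using c by (simp add: dens integral_density set_lebesgue_integral_def)
    finally show "(LINT g:((\<lambda>g. g - h) ` A)|L. u g) = c * (LINT g:A|L. u (g - h))" .
  qed (rule c)
qed

section \<open>Folner sets under translation\<close>

lemma invariant_part_sets:
  fixes S :: "'g set"
  assumes "compact S"
  shows "{g \<in> S. (\<lambda>k. k + g) ` K \<subseteq> S} \<in> sets borel"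
  by (intro borel_closed invariant_part_closed compact_imp_closed assms)

text \<open>Left multiplication by \<open>k\<close> commutes with right translation, so the
  invariant part of the translate is the translate of the invariant part, and both measures scale by
  the same \<open>c\<close>.\<close>

lemma invariant_compact_translate:
  assumes "invariant_compact L K \<epsilon> S"
  shows "invariant_compact L K \<epsilon> ((\<lambda>g. g - h) ` S)"
proof -
  obtain c where "0 < c"
    and c: "\<And>A. A \<in> sets borel \<Longrightarrow> measure L ((\<lambda>g. g - h) ` A) = c * measure L A"
    by (rule right_translate_scaling) blast
  let ?P = "\<lambda>S. {g \<in> S. (\<lambda>k. k + g) ` K \<subseteq> S}"
  have S: "compact S" "(1 - \<epsilon>) * measure L S < measure L (?P S)"
    using assms by (auto simp: invariant_compact_def)
  have mem: "x \<in> (\<lambda>g. g - h) ` A \<longleftrightarrow> x + h \<in> A" for x A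
    unfolding vimage_add_right[symmetric] by simp
  have eq: "?P ((\<lambda>g. g - h) ` S) = (\<lambda>g. g - h) ` ?P S"
    unfolding set_eq_iff mem image_subset_iff by (auto simp: mem add.assoc)
  have "measure L (?P ((\<lambda>g. g - h) ` S)) = c * measure L (?P S)"
    unfolding eq by (rule c[OF invariant_part_sets[OF S(1)]])
  moreover have "measure L ((\<lambda>g. g - h) ` S) = c * measure L S"
    by (rule c[OF borel_compact[OF S(1)]])
  ultimately have "(1 - \<epsilon>) * measure L ((\<lambda>g. g - h) ` S) < measure L (?P ((\<lambda>g. g - h) ` S))"
    using mult_strict_left_mono[OF S(2) \<open>0 < c\<close>] by (simp add: algebra_simps)
  then show ?thesis
    by (simp add: invariant_compact_def compact_translate S(1))
qed

lemma emeasure_F: "emeasure L (F n) = ennreal (measure L (F n))"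
  using emeasure_compact[OF compact_F[of n]] by (simp add: emeasure_eq_ennreal_measure less_top)

lemma measure_left: "measure L ((\<lambda>g. k + g) ` A) = measure L A" if "A \<in> sets borel"
  using that haar by (simp add: left_haar_measure_def measure_def)

lemma eventually_F_pos: "\<forall>\<^sub>F n in sequentially. 0 < measure L (F n)"
proof -
  \<comment> \<open>For \<open>K = {0}\<close> the invariant part is all of \<open>F n\<close>, and
    \<open>\<epsilon> = 1\<close> turns the strict inequality into positivity of its
    measure.\<close>
  have "\<forall>\<^sub>F n in sequentially. invariant_compact L {0} 1 (F n)"
    by (rule F_invariant) auto
  then show ?thesis
    by eventually_elim (simp add: invariant_compact_def)
qed

lemma boundary_small:
  assumes "0 < \<epsilon>"
  shows "\<forall>\<^sub>F n in sequentially.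
    measure L ((\<lambda>g. k + g) ` F n - F n) + measure L (F n - (\<lambda>g. k + g) ` F n) \<le> \<epsilon> * measure L (F n)"
proof -
  \<comment> \<open>\<open>- k + g \<in> F n\<close> means \<open>g \<in> k + F n\<close>, so the
    invariant part is the intersection of \<open>F n\<close> with its left translate. Both have the
    same measure, so each of the two differences gets half of \<open>\<epsilon>\<close>.\<close>
  have "\<forall>\<^sub>F n in sequentially. invariant_compact L {- k} (\<epsilon> / 2) (F n)"
    using assms by (intro F_invariant) auto
  then show ?thesis
  proof eventually_elim
    case (elim n)
    let ?k = "\<lambda>g. k + g"
    have [measurable]: "?k ` F n \<in> sets borel" by (rule image_left_sets[OF F_sets])
    have "x \<in> ?k ` F n \<longleftrightarrow> - k + x \<in> F n" for x
      by (auto simp: image_iff add.assoc[symmetric] intro!: bexI[of _ "- k + x"])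
    then have "{g \<in> F n. (\<lambda>k'. k' + g) ` {- k} \<subseteq> F n} = F n \<inter> ?k ` F n"
      by auto
    then have 1: "(1 - \<epsilon> / 2) * measure L (F n) < measure L (F n \<inter> ?k ` F n)"
      using elim by (simp add: invariant_compact_def)
    have fin: "emeasure L (F n) < \<infinity>" "emeasure L (?k ` F n) < \<infinity>"
      using emeasure_F[of n] haar by (auto simp: left_haar_measure_def compact_F)
    have "measure L (F n - ?k ` F n) = measure L (F n) - measure L (F n \<inter> ?k ` F n)"
      by (subst measure_Diff_Int) (use fin in \<open>auto simp: fmeasurable_def\<close>)
    moreover have "measure L (?k ` F n - F n) = measure L (?k ` F n) - measure L (?k ` F n \<inter> F n)"
      by (subst measure_Diff_Int) (use fin in \<open>auto simp: fmeasurable_def\<close>)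
    ultimately show ?case using 1 by (simp add: algebra_simps measure_left Int_commute)
  qed
qed

end

section \<open>Limits and projections in spaces of integrable functions\<close>

lemma integrable_indicator_mult: "A \<in> sets M \<Longrightarrow> integrable M w \<Longrightarrow> integrable M (\<lambda>x. indicator A x * w x :: real)"
  using integrable_mult_indicator[of A M w] by simp

text \<open>Monotone convergence: the sum of the absolute values has finite integral. It serves both
  the construction of \<open>L\<^sup>1\<close>-limits and the final almost everywhere
  convergence.\<close>

lemma AE_summable_integral:
  fixes u :: "nat \<Rightarrow> 'a \<Rightarrow> real"
  assumes i [measurable]: "\<And>n. integrable M (u n)"
    and s: "summable (\<lambda>n. LINT x|M. \<bar>u n x\<bar>)"
  shows "AE x in M. summable (\<lambda>n. \<bar>u n x\<bar>)"
proof -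
  have "(\<integral>\<^sup>+x. (\<Sum>n. ennreal \<bar>u n x\<bar>) \<partial>M) = (\<Sum>n. \<integral>\<^sup>+x. ennreal \<bar>u n x\<bar> \<partial>M)"
    by (rule nn_integral_suminf) measurable
  also have "\<dots> = (\<Sum>n. ennreal (LINT x|M. \<bar>u n x\<bar>))"
    by (intro arg_cong[where f = suminf] ext nn_integral_eq_integral) (auto intro: i)
  also have "\<dots> \<noteq> \<infinity>"
    using s by (simp add: ennreal_suminf_neq_top)
  finally have "AE x in M. (\<Sum>n. ennreal \<bar>u n x\<bar>) \<noteq> \<infinity>"
    by (intro nn_integral_PInf_AE) auto
  then show ?thesis
    by eventually_elim (auto intro: summable_suminf_not_top)
qed

lemma L1_limit:
  fixes v :: "nat \<Rightarrow> 'a \<Rightarrow> real"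
  assumes i [measurable]: "\<And>n. integrable M (v n)"
    and s: "summable (\<lambda>n. LINT x|M. \<bar>v (Suc n) x - v n x\<bar>)"
  obtains \<psi> where "integrable M \<psi>" "(\<lambda>n. LINT x|M. \<bar>v n x - \<psi> x\<bar>) \<longlonglongrightarrow> 0"
proof -
  define u where "u = (\<lambda>n x. v (Suc n) x - v n x)"
  have iu [measurable]: "integrable M (u n)" for n using i by (simp add: u_def)
  have su: "summable (\<lambda>n. LINT x|M. \<bar>u n x\<bar>)" using s by (simp add: u_def)
  have ae: "AE x in M. summable (\<lambda>n. \<bar>u n x\<bar>)"
    by (rule AE_summable_integral[OF iu su])
  define \<psi> where "\<psi> = (\<lambda>x. v 0 x + (\<Sum>n. u n x))"
  have ipsi: "integrable M \<psi>"
    unfolding \<psi>_def using i iu ae su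
    by (intro Bochner_Integration.integrable_add integrable_suminf) auto
  have iS: "integrable M (\<lambda>x. \<Sum>n. \<bar>u n x\<bar>)"
    using iu ae su by (intro integrable_suminf) auto
  have v: "v n x = v 0 x + (\<Sum>k<n. u k x)" for n x
    unfolding u_def by (induction n) auto
  have "(\<lambda>n. LINT x|M. \<bar>v n x - \<psi> x\<bar>) \<longlonglongrightarrow> (LINT x|M. 0)"
  proof (rule integral_dominated_convergence)
    \<comment> \<open>One copy of the series dominates the partial sum in \<open>v n\<close>, the
      other the full sum in \<open>\<psi>\<close>.\<close>
    show "integrable M (\<lambda>x. (\<Sum>n. \<bar>u n x\<bar>) + (\<Sum>n. \<bar>u n x\<bar>))"
      using iS by simp
    show "AE x in M. (\<lambda>n. \<bar>v n x - \<psi> x\<bar>) \<longlonglongrightarrow> 0"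
      using ae
    proof eventually_elim
      case (elim x)
      then have "(\<lambda>n. v 0 x + (\<Sum>k<n. u k x)) \<longlonglongrightarrow> \<psi> x"
        unfolding \<psi>_def by (intro tendsto_intros summable_LIMSEQ) (rule summable_rabs_cancel)
      then show ?case
        unfolding v[symmetric] by (rule tendsto_rabs_zero[OF LIM_zero])
    qed
    show "AE x in M. norm \<bar>v n x - \<psi> x\<bar> \<le> (\<Sum>n. \<bar>u n x\<bar>) + (\<Sum>n. \<bar>u n x\<bar>)" for n
      using ae
    proof eventually_elim
      case (elim x)
      have "\<bar>\<Sum>k<n. u k x\<bar> \<le> (\<Sum>k<n. \<bar>u k x\<bar>)" by (rule sum_abs)
      also have "\<dots> \<le> (\<Sum>n. \<bar>u n x\<bar>)" using elim by (intro sum_le_suminf) auto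
      finally have "\<bar>\<Sum>k<n. u k x\<bar> \<le> (\<Sum>n. \<bar>u n x\<bar>)" .
      moreover have "\<bar>\<Sum>n. u n x\<bar> \<le> (\<Sum>n. \<bar>u n x\<bar>)" using elim by (rule summable_rabs)
      ultimately show ?case unfolding v[of n x] \<psi>_def by simp
    qed
  qed (use ipsi in \<open>auto simp: i intro!: borel_measurable_diff borel_measurable_abs\<close>)
  then show thesis using that ipsi by simp
qed

text \<open>Projection of \<open>f\<close> along a space \<open>W\<close> of bounded functions. A minimizing sequence for the
  \<open>L\<^sup>2\<close>-distance is \<open>L\<^sup>2\<close>-Cauchy; its limit is taken in \<open>L\<^sup>1\<close>, which is enough because
  orthogonality is only tested against bounded functions.\<close>

lemma (in prob_space) L2_projection:
  fixes W :: "('a \<Rightarrow> real) set" and f :: "'a \<Rightarrow> real"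
  assumes W: "\<And>w. w \<in> W \<Longrightarrow> w \<in> borel_measurable M" "\<And>w. w \<in> W \<Longrightarrow> \<exists>C. \<forall>x\<in>space M. \<bar>w x\<bar> \<le> C"
    and lin: "\<And>w v a. w \<in> W \<Longrightarrow> v \<in> W \<Longrightarrow> (\<lambda>x. w x + a * v x) \<in> W"
    and ne: "W \<noteq> {}"
    and f: "f \<in> borel_measurable M" "\<exists>C. \<forall>x\<in>space M. \<bar>f x\<bar> \<le> C"
  obtains w \<psi> where "\<And>n. w n \<in> W" "integrable M \<psi>"
    "(\<lambda>n. expectation (\<lambda>x. \<bar>f x - w n x - \<psi> x\<bar>)) \<longlonglongrightarrow> 0"
    "\<And>v. v \<in> W \<Longrightarrow> expectation (\<lambda>x. \<psi> x * v x) = 0"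
proof -
  define bdd where "bdd u \<longleftrightarrow> u \<in> borel_measurable M \<and> (\<exists>C. \<forall>x\<in>space M. \<bar>u x\<bar> \<le> C)" for u :: "'a \<Rightarrow> real"
  have int: "integrable M u" if "bdd u" for u
    using that unfolding bdd_def by (metis AE_I2 integrable_const_bound real_norm_def)
  have add: "bdd (\<lambda>x. u x + v x)" if u: "bdd u" and v: "bdd v" for u v
  proof -
    obtain C C' where "\<forall>x\<in>space M. \<bar>u x\<bar> \<le> C" "\<forall>x\<in>space M. \<bar>v x\<bar> \<le> C'"
      using u v by (auto simp: bdd_def)
    then have "\<forall>x\<in>space M. \<bar>u x + v x\<bar> \<le> C + C'"
      by (auto intro: order_trans[OF abs_triangle_ineq] add_mono)
    then show ?thesis using u v by (auto simp: bdd_def)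
  qed
  have mult: "bdd (\<lambda>x. u x * v x)" if u: "bdd u" and v: "bdd v" for u v
  proof -
    obtain C C' where "\<forall>x\<in>space M. \<bar>u x\<bar> \<le> C" "\<forall>x\<in>space M. \<bar>v x\<bar> \<le> C'"
      using u v by (auto simp: bdd_def)
    then have "\<forall>x\<in>space M. \<bar>u x * v x\<bar> \<le> \<bar>C\<bar> * \<bar>C'\<bar>"
      unfolding abs_mult by (intro ballI mult_mono) (auto intro: order_trans)
    then show ?thesis using u v by (auto simp: bdd_def)
  qed
  have const: "bdd (\<lambda>x. c)" for c by (auto simp: bdd_def)
  have diff: "bdd (\<lambda>x. u x - v x)" if "bdd u" "bdd v" for u v
    using add[OF that(1) mult[OF const[of "- 1"] that(2)]] by simp
  have bW: "bdd w" if "w \<in> W" for w using W that by (auto simp: bdd_def)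
  have bf: "bdd f" using f by (simp add: bdd_def)
  define q where "q u = expectation (\<lambda>x. (u x)\<^sup>2)" for u :: "'a \<Rightarrow> real"
  have q: "q (\<lambda>x. u x + t * v x) = q u + 2 * t * expectation (\<lambda>x. u x * v x) + t\<^sup>2 * q v"
    if "bdd u" "bdd v" for u v t
  proof -
    have "q (\<lambda>x. u x + t * v x) = expectation (\<lambda>x. (u x * u x + 2 * t * (u x * v x)) + t\<^sup>2 * (v x * v x))"
      unfolding q_def by (intro Bochner_Integration.integral_cong) (auto simp: power2_eq_square algebra_simps)
    also have "\<dots> = q u + 2 * t * expectation (\<lambda>x. u x * v x) + t\<^sup>2 * q v"
      using int[OF mult[OF that(1) that(1)]] int[OF mult[OF that]] int[OF mult[OF that(2) that(2)]]
      by (simp add: q_def power2_eq_square)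
    finally show ?thesis .
  qed
  have q_nonneg: "0 \<le> q u" for u by (simp add: q_def)
  define m where "m = (INF w\<in>W. q (\<lambda>x. f x - w x))"
  have m_le: "m \<le> q (\<lambda>x. f x - w x)" if "w \<in> W" for w
    unfolding m_def by (rule cINF_lower[OF _ that]) (auto intro!: bdd_belowI2[where m = 0] q_nonneg)
  \<comment> \<open>The error is the square of \<open>(1 / 2) ^ n\<close>, so that the resulting
    distances are summable.\<close>
  have "\<exists>w\<in>W. q (\<lambda>x. f x - w x) < m + (1 / 4) ^ n" for n
  proof (rule ccontr)
    assume "\<not> ?thesis"
    then have "m + (1 / 4) ^ n \<le> m"
      unfolding m_def by (intro cINF_greatest[OF ne]) (auto simp: not_less m_def)
    moreover have "0 < (1 / 4 :: real) ^ n" by simp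
    ultimately show False by linarith
  qed
  then obtain w where w: "\<And>n. w n \<in> W" and qw: "\<And>n. q (\<lambda>x. f x - w n x) < m + (1 / 4) ^ n"
    by metis
  define r where "r n = (\<lambda>x. f x - w n x)" for n
  have br: "bdd (r n)" for n unfolding r_def by (intro diff bf bW w)
  have sq: "(1 / 2 :: real) ^ n * (1 / 2) ^ n = (1 / 4) ^ n" for n
    by (simp add: power_mult_distrib[symmetric])
  have orth: "\<bar>expectation (\<lambda>x. r n x * v x)\<bar> \<le> (1 / 2) ^ n * ((1 + q v) / 2)" if v: "v \<in> W" for n v
  proof -
    let ?e = "expectation (\<lambda>x. r n x * v x)"
    \<comment> \<open>First variation: minimality is tested against the perturbation
      \<open>t * v\<close>. Taking \<open>t\<close> as plus and minus \<open>(1 / 2) ^ n\<close> and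
      dividing by \<open>2 * \<bar>t\<bar>\<close> leaves a bound on \<open>?e\<close> that tends to
      0.\<close>
    have *: "- (2 * t * ?e) \<le> (1 / 4) ^ n * (1 + q v)" if "t\<^sup>2 = (1 / 4) ^ n" for t
    proof -
      have "m \<le> q (\<lambda>x. f x - (w n x + (- t) * v x))"
        by (intro m_le lin w v)
      also have "(\<lambda>x. f x - (w n x + (- t) * v x)) = (\<lambda>x. r n x + t * v x)"
        by (auto simp: r_def)
      finally have "m \<le> q (r n) + 2 * t * ?e + (1 / 4) ^ n * q v"
        by (simp add: q[OF br bW[OF v]] that)
      moreover have "q (r n) < m + (1 / 4) ^ n" using qw by (simp add: r_def)
      ultimately show ?thesis by (simp add: algebra_simps)
    qed
    have "(1 / 2) ^ n * \<bar>?e\<bar> \<le> (1 / 2) ^ n * ((1 / 2) ^ n * ((1 + q v) / 2))"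
      using *[of "(1 / 2) ^ n"] *[of "- ((1 / 2) ^ n)"]
      unfolding mult.assoc[symmetric] sq by (auto simp: abs_if power2_eq_square sq)
    then show ?thesis by (rule mult_left_le_imp_le) simp
  qed
  have cauchy: "expectation (\<lambda>x. \<bar>r (Suc n) x - r n x\<bar>) \<le> 3 * (1 / 2) ^ n" for n
  proof -
    define u where "u = (\<lambda>x. r (Suc n) x - r n x)"
    have bu: "bdd u" unfolding u_def by (intro diff br)
    \<comment> \<open>The midpoint of \<open>w n\<close> and \<open>w (Suc n)\<close>: comparing its
      distance with \<open>m\<close> is the parallelogram argument that bounds
      \<open>q u\<close>.\<close>
    have "(\<lambda>x. w n x + (1 / 2) * (w (Suc n) x + (- 1) * w n x)) \<in> W"
      by (intro lin w)
    then have "m \<le> q (\<lambda>x. f x - (w n x + (1 / 2) * (w (Suc n) x + (- 1) * w n x)))"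
      by (rule m_le)
    also have "(\<lambda>x. f x - (w n x + (1 / 2) * (w (Suc n) x + (- 1) * w n x))) = (\<lambda>x. r n x + (1 / 2) * u x)"
      by (auto simp: u_def r_def field_simps)
    finally have 1: "m \<le> q (r n) + expectation (\<lambda>x. r n x * u x) + q u / 4"
      unfolding q[OF br bu] by (simp add: power2_eq_square)
    have "q (r (Suc n)) = q (\<lambda>x. r n x + 1 * u x)" by (simp add: u_def)
    also have "\<dots> = q (r n) + 2 * expectation (\<lambda>x. r n x * u x) + q u"
      by (subst q[OF br bu]) simp
    finally have 2: "q (r (Suc n)) = q (r n) + 2 * expectation (\<lambda>x. r n x * u x) + q u" .
    have "q (r n) < m + (1 / 4) ^ n" "q (r (Suc n)) < m + (1 / 4) ^ n / 4"
      using qw[of n] qw[of "Suc n"] by (auto simp: r_def)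
    moreover have "0 \<le> (1 / 4 :: real) ^ n" by simp
    ultimately have qu: "q u \<le> 4 * (1 / 4) ^ n"
      using 1 2 by linarith
    \<comment> \<open>In place of Cauchy-Schwarz, the arithmetic-geometric inequality with weight
      \<open>2 ^ n\<close> turns the bound on \<open>q u\<close> into a summable
      \<open>L\<^sup>1\<close>-bound.\<close>
    have "expectation (\<lambda>x. \<bar>u x\<bar>) \<le> expectation (\<lambda>x. (2 ^ n * (u x * u x) + (1 / 2) ^ n) / 2)"
    proof (rule integral_mono)
      show "\<bar>u x\<bar> \<le> (2 ^ n * (u x * u x) + (1 / 2) ^ n) / 2" for x
      proof -
        have "0 \<le> 2 ^ n * (\<bar>u x\<bar> - (1 / 2) ^ n)\<^sup>2" by simp
        also have "\<dots> = 2 ^ n * (u x * u x) - 2 * (2 ^ n * (1 / 2) ^ n) * \<bar>u x\<bar> + 2 ^ n * (1 / 2) ^ n * (1 / 2) ^ n"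
          by (simp add: power2_eq_square algebra_simps abs_mult_self_eq)
        also have "(2 :: real) ^ n * (1 / 2) ^ n = 1" by (simp add: power_mult_distrib[symmetric])
        finally show ?thesis by simp
      qed
    qed (use int[OF bu] int[OF mult[OF bu bu]] in auto)
    also have "\<dots> = (2 ^ n * q u + (1 / 2) ^ n) / 2"
      using int[OF mult[OF bu bu]] by (simp add: q_def power2_eq_square prob_space)
    also have "\<dots> \<le> (2 ^ n * (4 * (1 / 4) ^ n) + (1 / 2) ^ n) / 2"
      using qu by (intro divide_right_mono add_right_mono mult_left_mono) auto
    also have "(2 :: real) ^ n * (4 * (1 / 4) ^ n) = 4 * (1 / 2) ^ n"
      by (simp add: power_mult_distrib[symmetric])
    also have "(4 * (1 / 2) ^ n + (1 / 2) ^ n) / 2 \<le> 3 * (1 / 2 :: real) ^ n"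
      by (simp add: field_simps)
    finally show ?thesis unfolding u_def .
  qed
  have "summable (\<lambda>n. expectation (\<lambda>x. \<bar>r (Suc n) x - r n x\<bar>))"
  proof (rule summable_comparison_test)
    show "\<exists>N. \<forall>n\<ge>N. norm (expectation (\<lambda>x. \<bar>r (Suc n) x - r n x\<bar>)) \<le> 3 * (1 / 2) ^ n"
      using cauchy by auto
  qed (intro summable_mult summable_geometric, simp)
  then obtain \<psi> where psi: "integrable M \<psi>" "(\<lambda>n. expectation (\<lambda>x. \<bar>r n x - \<psi> x\<bar>)) \<longlonglongrightarrow> 0"
    using L1_limit[of M r] int[OF br] by blast
  show thesis
  proof
    show "(\<lambda>n. expectation (\<lambda>x. \<bar>f x - w n x - \<psi> x\<bar>)) \<longlonglongrightarrow> 0"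
      using psi(2) by (simp add: r_def)
    fix v assume v: "v \<in> W"
    obtain C where C: "\<And>x. x \<in> space M \<Longrightarrow> \<bar>v x\<bar> \<le> C" using W(2)[OF v] by blast
    have [measurable]: "v \<in> borel_measurable M" by (rule W(1)[OF v])
    have C': "x \<in> space M \<Longrightarrow> \<bar>v x\<bar> \<le> \<bar>C\<bar>" for x using C[of x] by simp
    have ib: "integrable M (\<lambda>x. u x * v x)" if "integrable M u" for u
    proof (rule Bochner_Integration.integrable_bound)
      show "integrable M (\<lambda>x. u x * \<bar>C\<bar>)" using that by simp
      show "AE x in M. norm (u x * v x) \<le> norm (u x * \<bar>C\<bar>)"
        using C' by (auto simp: abs_mult intro!: mult_left_mono)
    qed (use that in auto)
    have "(\<lambda>n. expectation (\<lambda>x. r n x * v x)) \<longlonglongrightarrow> 0"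
    proof (rule tendsto_rabs_zero_cancel, rule tendsto_sandwich[OF _ _ tendsto_const])
      show "(\<lambda>n. (1 / 2) ^ n * ((1 + q v) / 2)) \<longlonglongrightarrow> 0"
        by (intro tendsto_mult_left_zero LIMSEQ_power_zero) simp
    qed (use orth[OF v] in auto)
    moreover have "(\<lambda>n. expectation (\<lambda>x. r n x * v x) - expectation (\<lambda>x. \<psi> x * v x)) \<longlonglongrightarrow> 0"
    proof (rule tendsto_rabs_zero_cancel, rule tendsto_sandwich[OF _ _ tendsto_const])
      show "(\<lambda>n. expectation (\<lambda>x. \<bar>r n x - \<psi> x\<bar>) * \<bar>C\<bar>) \<longlonglongrightarrow> 0"
        by (intro tendsto_mult_left_zero psi)
      have "\<bar>expectation (\<lambda>x. r n x * v x) - expectation (\<lambda>x. \<psi> x * v x)\<bar>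
          \<le> expectation (\<lambda>x. \<bar>r n x - \<psi> x\<bar>) * \<bar>C\<bar>" for n
      proof -
        have i: "integrable M (\<lambda>x. r n x - \<psi> x)" using int[OF br] psi(1) by simp
        have "expectation (\<lambda>x. r n x * v x) - expectation (\<lambda>x. \<psi> x * v x)
            = expectation (\<lambda>x. (r n x - \<psi> x) * v x)"
          using ib[OF int[OF br]] ib[OF psi(1)] by (simp add: left_diff_distrib)
        also have "\<bar>\<dots>\<bar> \<le> expectation (\<lambda>x. \<bar>(r n x - \<psi> x) * v x\<bar>)"
          by (rule integral_abs_bound)
        also have "\<dots> \<le> expectation (\<lambda>x. \<bar>r n x - \<psi> x\<bar> * \<bar>C\<bar>)"
          using i integrable_abs[OF ib[OF i], unfolded abs_mult] C' by (intro integral_mono) (auto simp: abs_mult intro!: mult_left_mono)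
        finally show ?thesis by simp
      qed
      then show "\<forall>\<^sub>F n in sequentially. \<bar>expectation (\<lambda>x. r n x * v x) - expectation (\<lambda>x. \<psi> x * v x)\<bar>
          \<le> expectation (\<lambda>x. \<bar>r n x - \<psi> x\<bar>) * \<bar>C\<bar>" by simp
    qed simp
    ultimately have "(\<lambda>n. - expectation (\<lambda>x. \<psi> x * v x)) \<longlonglongrightarrow> 0"
      using tendsto_diff by fastforce
    then show "expectation (\<lambda>x. \<psi> x * v x) = 0"
      by (simp add: LIMSEQ_const_iff)
  qed (use w psi in auto)
qed

section \<open>Averages of the Koopman operators on integrable functions\<close>

locale nonsingular_action = amenable_haar L F
  for L :: "'g::{polish_space,topological_group_add} measure" and F :: "nat \<Rightarrow> 'g set" +
  fixes M :: "'x measure" and act :: "'g \<Rightarrow> 'x \<Rightarrow> 'x" and D :: "'g \<Rightarrow> 'x \<Rightarrow> real"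
  assumes nonsingular: "nonsingular_probability_G_space act M"
    and cocycle: "RN_cocycle act M D"
begin

sublocale prob_space M
  using nonsingular by (simp add: nonsingular_probability_G_space_def)

sublocale LM: pair_sigma_finite L M ..

lemma G_space: "borel_G_space act M"
  using nonsingular by (simp add: nonsingular_probability_G_space_def)

lemma act_measurable [measurable (raw)]:
  assumes [measurable]: "f \<in> borel_measurable N" "h \<in> measurable N M"
  shows "(\<lambda>z. act (f z) (h z)) \<in> measurable N M"
proof -
  have [measurable]: "(\<lambda>(g, x). act g x) \<in> measurable (borel \<Otimes>\<^sub>M M) M"
    using G_space by (simp add: borel_G_space_def)
  have "(\<lambda>(g, x). act g x) \<circ> (\<lambda>z. (f z, h z)) \<in> measurable N M"
    by measurable
  then show ?thesis by (simp add: comp_def)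
qed

lemma D_measurable [measurable (raw)]:
  assumes [measurable]: "f \<in> borel_measurable N" "h \<in> measurable N M"
  shows "(\<lambda>z. D (f z) (h z)) \<in> borel_measurable N"
proof -
  have [measurable]: "(\<lambda>(g, x). D g x) \<in> borel_measurable (borel \<Otimes>\<^sub>M M)"
    using cocycle by (simp add: RN_cocycle_def)
  have "(\<lambda>(g, x). D g x) \<circ> (\<lambda>z. (f z, h z)) \<in> borel_measurable N"
    by measurable
  then show ?thesis by (simp add: comp_def)
qed

lemma act_space [simp]: "x \<in> space M \<Longrightarrow> act g x \<in> space M"
  using measurable_space[OF borel_G_space_measurable[OF G_space]] .

lemma act_zero [simp]: "x \<in> space M \<Longrightarrow> act 0 x = x"
  using G_space by (simp add: borel_G_space_def)

lemma act_act: "x \<in> space M \<Longrightarrow> act g (act h x) = act (g + h) x"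
  using G_space by (simp add: borel_G_space_def)

section \<open>The cocycle and change of variables\<close>

lemma D_pos: "x \<in> space M \<Longrightarrow> 0 < D g x"
  using cocycle by (simp add: RN_cocycle_def)

lemma D_nonneg: "x \<in> space M \<Longrightarrow> 0 \<le> D g x"
  using D_pos[of x g] by simp

lemma D_add: "x \<in> space M \<Longrightarrow> D (g + h) x = D g (act h x) * D h x"
  using cocycle by (simp add: RN_cocycle_def)

text \<open>\<open>D k\<close> is the density of the push-forward of \<open>M\<close> along
  \<open>act (- k)\<close>; pushing forward along \<open>act k\<close> undoes this. Every later
  substitution in \<open>x\<close> rests on it.\<close>

lemma distr_density_D: "distr (density M (\<lambda>x. ennreal (D k x))) M (act k) = M"
proof -
  have "density M (\<lambda>x. ennreal (D k x)) = density M (RN_deriv M (distr M M (act (- k))))"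
    using cocycle by (intro density_cong) (auto simp: RN_cocycle_def)
  also have "\<dots> = distr M M (act (- k))"
    using nonsingular by (intro density_RN_deriv) (auto simp: nonsingular_probability_G_space_def)
  finally have "distr (density M (\<lambda>x. ennreal (D k x))) M (act k) = distr (distr M M (act (- k))) M (act k)"
    by simp
  also have "\<dots> = distr M M (\<lambda>x. act k (act (- k) x))"
    by (subst distr_distr) (auto simp: comp_def)
  also have "\<dots> = distr M M (\<lambda>x. x)"
    by (intro distr_cong) (auto simp: act_act)
  finally show ?thesis by simp
qed

lemma nn_integral_translate:
  assumes [measurable]: "u \<in> borel_measurable M"
  shows "(\<integral>\<^sup>+x. ennreal (D k x) * u (act k x) \<partial>M) = (\<integral>\<^sup>+x. u x \<partial>M)"
proof -
  have "(\<integral>\<^sup>+x. u x \<partial>M) = (\<integral>\<^sup>+x. u x \<partial>distr (density M (\<lambda>x. ennreal (D k x))) M (act k))"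
    by (simp add: distr_density_D)
  also have "\<dots> = (\<integral>\<^sup>+x. ennreal (D k x) * u (act k x) \<partial>M)"
    by (simp add: nn_integral_distr nn_integral_density)
  finally show ?thesis ..
qed

lemma
  fixes f :: "'x \<Rightarrow> real"
  assumes f [measurable]: "integrable M f"
  shows integrable_translate: "integrable M (\<lambda>x. D k x * f (act k x))"
    and integral_translate: "(LINT x|M. D k x * f (act k x)) = (LINT x|M. f x)"
proof -
  have "integrable (distr (density M (\<lambda>x. ennreal (D k x))) M (act k)) f"
    using f by (simp add: distr_density_D)
  then have "integrable (density M (\<lambda>x. ennreal (D k x))) (\<lambda>x. f (act k x))"
    by (subst (asm) integrable_distr_eq) auto
  then show "integrable M (\<lambda>x. D k x * f (act k x))"
    by (subst (asm) integrable_density) (auto intro: D_nonneg)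
  have "(LINT x|M. f x) = (LINT x|distr (density M (\<lambda>x. ennreal (D k x))) M (act k). f x)"
    by (simp add: distr_density_D)
  also have "\<dots> = (LINT x|M. D k x * f (act k x))"
    by (subst integral_distr) (auto simp: integral_density D_nonneg)
  finally show "(LINT x|M. D k x * f (act k x)) = (LINT x|M. f x)" ..
qed

text \<open>The unnormalised mean of \<open>T\<^sub>g f\<close> over \<open>g \<in> B\<close>: the
  numerator of the ratio average, and for \<open>f = 1\<close> its denominator. Linearity holds only
  almost everywhere, because a nonintegrable orbit gets the value 0.\<close>

definition orbit_integral :: "'g set \<Rightarrow> ('x \<Rightarrow> real) \<Rightarrow> 'x \<Rightarrow> real" where
  "orbit_integral B f x = (LINT g:B|L. D g x * f (act g x))"

lemma orbit_integral_measurable [measurable]: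
  assumes [measurable]: "B \<in> sets borel" "f \<in> borel_measurable M"
  shows "orbit_integral B f \<in> borel_measurable M"
  unfolding orbit_integral_def set_lebesgue_integral_def by measurable

text \<open>Tonelli, and every \<open>T\<^sub>g\<close> preserves the
  \<open>L\<^sup>1\<close>-norm.\<close>

lemma nn_integral_orbit_integral:
  assumes [measurable]: "B \<in> sets borel" "f \<in> borel_measurable M"
  shows "(\<integral>\<^sup>+x. \<integral>\<^sup>+g. ennreal (norm (indicator B g *\<^sub>R (D g x * f (act g x)))) \<partial>L \<partial>M)
    = emeasure L B * (\<integral>\<^sup>+x. ennreal \<bar>f x\<bar> \<partial>M)"
proof -
  have "(\<integral>\<^sup>+x. \<integral>\<^sup>+g. ennreal (norm (indicator B g *\<^sub>R (D g x * f (act g x)))) \<partial>L \<partial>M)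
    = (\<integral>\<^sup>+g. \<integral>\<^sup>+x. ennreal (norm (indicator B g *\<^sub>R (D g x * f (act g x)))) \<partial>M \<partial>L)"
    by (rule LM.Fubini') measurable
  also have "\<dots> = (\<integral>\<^sup>+g. indicator B g * (\<integral>\<^sup>+x. ennreal (D g x) * ennreal \<bar>f (act g x)\<bar> \<partial>M) \<partial>L)"
    by (intro nn_integral_cong)
       (auto simp: abs_mult D_nonneg ennreal_mult' abs_of_nonneg split: split_indicator intro!: nn_integral_cong)
  also have "\<dots> = (\<integral>\<^sup>+g. indicator B g * (\<integral>\<^sup>+x. ennreal \<bar>f x\<bar> \<partial>M) \<partial>L)"
    by (subst nn_integral_translate[where u = "\<lambda>x. ennreal \<bar>f x\<bar>"]) auto
  also have "\<dots> = emeasure L B * (\<integral>\<^sup>+x. ennreal \<bar>f x\<bar> \<partial>M)"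
    by (subst nn_integral_multc) auto
  finally show ?thesis .
qed

lemma nn_integral_abs_finite:
  assumes "integrable M f"
  shows "(\<integral>\<^sup>+x. ennreal \<bar>f x\<bar> \<partial>M) = ennreal (LINT x|M. \<bar>f x\<bar>)"
  using assms by (intro nn_integral_eq_integral) auto

lemma AE_set_integrable:
  assumes f: "integrable M f" and B: "B \<in> fmeasurable L"
  shows "AE x in M. set_integrable L B (\<lambda>g. D g x * f (act g x))"
proof -
  have [measurable]: "B \<in> sets borel" "f \<in> borel_measurable M"
    using assms by auto
  have "AE x in M. (\<integral>\<^sup>+g. ennreal (norm (indicator B g *\<^sub>R (D g x * f (act g x)))) \<partial>L) \<noteq> \<infinity>"
  proof (rule nn_integral_PInf_AE)
    show "(\<integral>\<^sup>+x. \<integral>\<^sup>+g. ennreal (norm (indicator B g *\<^sub>R (D g x * f (act g x)))) \<partial>L \<partial>M) \<noteq> \<infinity>"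
      using B f by (subst nn_integral_orbit_integral)
        (auto simp: nn_integral_abs_finite fmeasurable_def ennreal_mult_eq_top_iff)
  qed measurable
  with AE_space show ?thesis
  proof eventually_elim
    case (elim x)
    have [measurable]: "(\<lambda>g. x) \<in> measurable N M" for N using elim(1) by simp
    show ?case using elim(2) by (auto simp: set_integrable_def integrable_iff_bounded less_top)
  qed
qed

lemma
  assumes f: "integrable M f" and B: "B \<in> fmeasurable L"
  shows orbit_integral_integrable: "integrable M (orbit_integral B f)"
    and orbit_integral_bound: "(LINT x|M. \<bar>orbit_integral B f x\<bar>) \<le> measure L B * (LINT x|M. \<bar>f x\<bar>)"
proof -
  have [measurable]: "B \<in> sets borel" "f \<in> borel_measurable M"
    using assms by auto
  have "(\<integral>\<^sup>+x. ennreal (norm (orbit_integral B f x)) \<partial>M)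
    \<le> (\<integral>\<^sup>+x. \<integral>\<^sup>+g. ennreal (norm (indicator B g *\<^sub>R (D g x * f (act g x)))) \<partial>L \<partial>M)"
  proof (rule nn_integral_mono_AE)
    show "AE x in M. ennreal (norm (orbit_integral B f x))
        \<le> (\<integral>\<^sup>+g. ennreal (norm (indicator B g *\<^sub>R (D g x * f (act g x)))) \<partial>L)"
      using AE_set_integrable[OF assms]
    proof eventually_elim
      case (elim x)
      show ?case
        unfolding orbit_integral_def set_lebesgue_integral_def
        by (rule integral_norm_bound_ennreal[OF elim[unfolded set_integrable_def]])
    qed
  qed
  also have "\<dots> = ennreal (measure L B * (LINT x|M. \<bar>f x\<bar>))"
    by (subst nn_integral_orbit_integral)
      (simp_all add: nn_integral_abs_finite[OF f] emeasure_eq_measure2[OF B] ennreal_mult')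
  finally have *: "(\<integral>\<^sup>+x. ennreal (norm (orbit_integral B f x)) \<partial>M) \<le> ennreal (measure L B * (LINT x|M. \<bar>f x\<bar>))" .
  then show i: "integrable M (orbit_integral B f)"
    by (intro integrableI_bounded) (auto intro: le_less_trans)
  from * show "(LINT x|M. \<bar>orbit_integral B f x\<bar>) \<le> measure L B * (LINT x|M. \<bar>f x\<bar>)"
    using nn_integral_abs_finite[OF i] by (simp add: ennreal_le_iff)
qed

lemma orbit_integral_lincomb:
  assumes "integrable M f" "integrable M h" "B \<in> fmeasurable L"
  shows "AE x in M. orbit_integral B (\<lambda>x. f x + a * h x) x = orbit_integral B f x + a * orbit_integral B h x"
  using AE_set_integrable[OF assms(1,3)] AE_set_integrable[OF assms(2,3)]
proof eventually_elim
  case (elim x)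
  have "orbit_integral B (\<lambda>x. f x + a * h x) x
    = (LINT g:B|L. D g x * f (act g x) + a * (D g x * h (act g x)))"
    by (simp add: orbit_integral_def algebra_simps)
  also have "\<dots> = orbit_integral B f x + a * orbit_integral B h x"
    using elim by (subst set_integral_add) (auto simp: orbit_integral_def)
  finally show ?case .
qed

lemma F_fm [simp]: "F n \<in> fmeasurable L"
  using emeasure_compact[OF compact_F[of n]] by (auto simp: fmeasurable_def)

text \<open>The normalisation is the Haar measure of \<open>F n\<close>, not the denominator of the
  ratio average. This makes the condition stable under linear combinations and
  \<open>L\<^sup>1\<close>-limits; the ratios come back through
  \<open>nn_integral_translate_norm\<close>.\<close>

definition averages_vanish :: "('x \<Rightarrow> real) \<Rightarrow> bool" where
  "averages_vanish f \<longleftrightarrow> integrable M f \<and> (\<lambda>n. (LINT x|M. \<bar>orbit_integral (F n) f x\<bar>) / measure L (F n)) \<longlonglongrightarrow> 0"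

lemma averages_vanish_lincomb:
  assumes "averages_vanish f" "averages_vanish h"
  shows "averages_vanish (\<lambda>x. f x + a * h x)"
  unfolding averages_vanish_def
proof
  have i: "integrable M f" "integrable M h" using assms by (auto simp: averages_vanish_def)
  then show "integrable M (\<lambda>x. f x + a * h x)" by auto
  let ?I = "\<lambda>n f. LINT x|M. \<bar>orbit_integral (F n) f x\<bar>"
  have le: "?I n (\<lambda>x. f x + a * h x) \<le> ?I n f + \<bar>a\<bar> * ?I n h" for n
  proof -
    have "?I n (\<lambda>x. f x + a * h x) = (LINT x|M. \<bar>orbit_integral (F n) f x + a * orbit_integral (F n) h x\<bar>)"
      by (intro integral_cong_AE)
         (use orbit_integral_lincomb[OF i F_fm, of n a] i in \<open>auto intro!: borel_measurable_abs orbit_integral_measurable\<close>)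
    also have "\<dots> \<le> (LINT x|M. \<bar>orbit_integral (F n) f x\<bar> + \<bar>a\<bar> * \<bar>orbit_integral (F n) h x\<bar>)"
      using i by (intro integral_mono)
        (auto simp: orbit_integral_integrable intro: order_trans[OF abs_triangle_ineq] simp flip: abs_mult)
    also have "\<dots> = ?I n f + \<bar>a\<bar> * ?I n h"
      using i by (subst Bochner_Integration.integral_add) (auto simp: orbit_integral_integrable)
    finally show ?thesis .
  qed
  have "(\<lambda>n. ?I n f / measure L (F n) + \<bar>a\<bar> * (?I n h / measure L (F n))) \<longlonglongrightarrow> 0 + \<bar>a\<bar> * 0"
    using assms unfolding averages_vanish_def by (intro tendsto_intros) auto
  then have lim: "(\<lambda>n. (?I n f + \<bar>a\<bar> * ?I n h) / measure L (F n)) \<longlonglongrightarrow> 0"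
    by (simp add: add_divide_distrib)
  show "(\<lambda>n. ?I n (\<lambda>x. f x + a * h x) / measure L (F n)) \<longlonglongrightarrow> 0"
    by (rule tendsto_sandwich[OF _ _ tendsto_const lim])
       (auto intro!: always_eventually divide_right_mono le)
qed

text \<open>The normalised means are \<open>L\<^sup>1\<close>-contractions, so the approximation
  error is bounded uniformly in \<open>n\<close>.\<close>

lemma averages_vanish_limit:
  assumes i: "integrable M f"
    and appr: "\<And>e. 0 < e \<Longrightarrow> \<exists>h. averages_vanish h \<and> (LINT x|M. \<bar>f x - h x\<bar>) \<le> e"
  shows "averages_vanish f"
  unfolding averages_vanish_def
proof (intro conjI i)
  show "(\<lambda>n. (LINT x|M. \<bar>orbit_integral (F n) f x\<bar>) / measure L (F n)) \<longlonglongrightarrow> 0"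
  proof (rule LIMSEQ_I)
    fix e :: real assume "0 < e"
    then obtain h where h: "averages_vanish h" and fh: "(LINT x|M. \<bar>f x - h x\<bar>) \<le> e / 3"
      using appr[of "e / 3"] by auto
    have ih: "integrable M h" using h by (simp add: averages_vanish_def)
    then have id: "integrable M (\<lambda>x. f x - h x)" using i by simp
    have le: "(LINT x|M. \<bar>orbit_integral (F n) f x\<bar>) \<le> (LINT x|M. \<bar>orbit_integral (F n) h x\<bar>) + measure L (F n) * (e / 3)" for n
    proof -
      have "AE x in M. orbit_integral (F n) f x = orbit_integral (F n) h x + orbit_integral (F n) (\<lambda>x. f x - h x) x"
        using orbit_integral_lincomb[OF ih id F_fm, of n 1] by simp
      then have "(LINT x|M. \<bar>orbit_integral (F n) f x\<bar>) \<le> (LINT x|M. \<bar>orbit_integral (F n) h x\<bar> + \<bar>orbit_integral (F n) (\<lambda>x. f x - h x) x\<bar>)"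
        using i ih id by (intro integral_mono_AE) (auto simp: orbit_integral_integrable)
      also have "\<dots> = (LINT x|M. \<bar>orbit_integral (F n) h x\<bar>) + (LINT x|M. \<bar>orbit_integral (F n) (\<lambda>x. f x - h x) x\<bar>)"
        using ih id by (subst Bochner_Integration.integral_add) (auto simp: orbit_integral_integrable)
      also have "\<dots> \<le> (LINT x|M. \<bar>orbit_integral (F n) h x\<bar>) + measure L (F n) * (e / 3)"
        using orbit_integral_bound[OF id F_fm, of n] mult_left_mono[OF fh, of "measure L (F n)"] by simp
      finally show ?thesis .
    qed
    have aux: "a < m * e" if "a \<le> b + m * (e / 3)" "b < m * (e / 3)" "0 < m * e" for a b m :: real
      using that by simp
    have "\<forall>\<^sub>F n in sequentially. (LINT x|M. \<bar>orbit_integral (F n) h x\<bar>) / measure L (F n) < e / 3"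
      using h \<open>0 < e\<close> unfolding averages_vanish_def by (intro order_tendstoD) auto
    with eventually_F_pos
    have "\<forall>\<^sub>F n in sequentially. norm ((LINT x|M. \<bar>orbit_integral (F n) f x\<bar>) / measure L (F n) - 0) < e"
    proof eventually_elim
      case (elim n)
      then have "(LINT x|M. \<bar>orbit_integral (F n) f x\<bar>) \<le> (LINT x|M. \<bar>orbit_integral (F n) h x\<bar>) + measure L (F n) * (e / 3)"
        "(LINT x|M. \<bar>orbit_integral (F n) h x\<bar>) < measure L (F n) * (e / 3)"
        using le[of n] by (auto simp: field_simps)
      then have "(LINT x|M. \<bar>orbit_integral (F n) f x\<bar>) < measure L (F n) * e"
        using mult_pos_pos[OF elim(1) \<open>0 < e\<close>] by (rule aux)
      then show ?case using elim(1) by (simp add: field_simps)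
    qed
    then show "\<exists>no. \<forall>n\<ge>no. norm ((LINT x|M. \<bar>orbit_integral (F n) f x\<bar>) / measure L (F n) - 0) < e"
      by (simp add: eventually_sequentially)
  qed
qed

text \<open>The cocycle identity makes \<open>T\<^sub>g\<close> applied to
  \<open>T\<^sub>k f\<close> the operator at \<open>k + g\<close>, and left invariance of
  \<open>L\<close> moves the shift by \<open>k\<close> onto \<open>B\<close>.\<close>

lemma orbit_integral_translate:
  assumes [measurable]: "B \<in> sets borel" "f \<in> borel_measurable M" and x: "x \<in> space M"
  shows "orbit_integral B (\<lambda>x. D k x * f (act k x)) x = orbit_integral ((\<lambda>g. k + g) ` B) f x"
proof -
  have [measurable]: "(\<lambda>g. k + g) ` B \<in> sets borel" by (rule image_left_sets) fact
  have [measurable]: "(\<lambda>g. x) \<in> measurable N M" for N using x by simp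
  have ind: "indicator ((\<lambda>g. k + g) ` B) (k + g) = (indicator B g :: real)" for g
    by (auto simp: indicator_def)
  have "orbit_integral ((\<lambda>g. k + g) ` B) f x =
      (LINT g|distr L L (\<lambda>g. k + g). indicator ((\<lambda>g. k + g) ` B) g * (D g x * f (act g x)))"
    by (simp add: orbit_integral_def set_lebesgue_integral_def distr_left)
  also have "\<dots> = (LINT g|L. indicator ((\<lambda>g. k + g) ` B) (k + g) * (D (k + g) x * f (act (k + g) x)))"
    by (subst integral_distr) auto
  also have "\<dots> = orbit_integral B (\<lambda>x. D k x * f (act k x)) x"
    using x by (simp add: ind orbit_integral_def set_lebesgue_integral_def D_add act_act mult_ac)
  finally show ?thesis ..
qed

lemma orbit_integral_Un:
  assumes f: "integrable M f" and "A \<in> fmeasurable L" "B \<in> fmeasurable L" "A \<inter> B = {}"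
  shows "AE x in M. orbit_integral (A \<union> B) f x = orbit_integral A f x + orbit_integral B f x"
  using AE_set_integrable[OF f assms(2)] AE_set_integrable[OF f assms(3)]
  by eventually_elim (auto simp: orbit_integral_def set_integral_Un assms(4))

text \<open>The orbit integral of a coboundary is the difference of those of \<open>f\<close> over
  \<open>k + F n\<close> and \<open>F n\<close>. The common part cancels, and
  \<open>boundary_small\<close> controls the rest.\<close>

lemma averages_vanish_coboundary:
  assumes f: "integrable M f"
  shows "averages_vanish (\<lambda>x. D k x * f (act k x) - f x)"
  unfolding averages_vanish_def
proof
  let ?w = "\<lambda>x. D k x * f (act k x) - f x"
  have [measurable]: "f \<in> borel_measurable M" using f by auto
  show iw: "integrable M ?w" using f integrable_translate[OF f] by simp
  let ?k = "\<lambda>g. k + g"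
  let ?d = "\<lambda>n. measure L (?k ` F n - F n) + measure L (F n - ?k ` F n)"
  have le: "(LINT x|M. \<bar>orbit_integral (F n) ?w x\<bar>) \<le> ?d n * (LINT x|M. \<bar>f x\<bar>)" for n
  proof -
    have k: "?k ` F n \<in> fmeasurable L"
      using haar emeasure_compact[OF compact_F[of n]] F_sets[of n]
      by (auto simp: fmeasurable_def left_haar_measure_def intro!: image_left_sets)
    have fm: "?k ` F n \<inter> F n \<in> fmeasurable L" "?k ` F n - F n \<in> fmeasurable L"
      "F n - ?k ` F n \<in> fmeasurable L"
      using k by (auto intro: fmeasurable_Diff fmeasurable_Int_fmeasurable)
    have "AE x in M. orbit_integral (F n) ?w x = orbit_integral (?k ` F n) f x - orbit_integral (F n) f x"
      using orbit_integral_lincomb[OF integrable_translate[OF f] f F_fm, of n k "- 1"] AE_space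
      by eventually_elim (simp add: orbit_integral_translate)
    moreover have "AE x in M. orbit_integral (?k ` F n) f x = orbit_integral (?k ` F n \<inter> F n) f x + orbit_integral (?k ` F n - F n) f x"
      using orbit_integral_Un[OF f fm(1,2)] by (simp add: Int_Diff_Un Diff_Int_distrib Int_Diff)
    moreover have "AE x in M. orbit_integral (F n) f x = orbit_integral (?k ` F n \<inter> F n) f x + orbit_integral (F n - ?k ` F n) f x"
      using orbit_integral_Un[OF f fm(1,3)] by (auto simp: Int_Diff_Un Int_commute)
    ultimately have "AE x in M. \<bar>orbit_integral (F n) ?w x\<bar> \<le> \<bar>orbit_integral (?k ` F n - F n) f x\<bar> + \<bar>orbit_integral (F n - ?k ` F n) f x\<bar>"
      by eventually_elim simp
    then have "(LINT x|M. \<bar>orbit_integral (F n) ?w x\<bar>)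
        \<le> (LINT x|M. \<bar>orbit_integral (?k ` F n - F n) f x\<bar> + \<bar>orbit_integral (F n - ?k ` F n) f x\<bar>)"
      using fm f iw by (intro integral_mono_AE) (auto simp: orbit_integral_integrable)
    also have "\<dots> = (LINT x|M. \<bar>orbit_integral (?k ` F n - F n) f x\<bar>) + (LINT x|M. \<bar>orbit_integral (F n - ?k ` F n) f x\<bar>)"
      using fm f by (subst Bochner_Integration.integral_add) (auto simp: orbit_integral_integrable)
    also have "\<dots> \<le> ?d n * (LINT x|M. \<bar>f x\<bar>)"
      using orbit_integral_bound[OF f fm(2)] orbit_integral_bound[OF f fm(3)] by (simp add: algebra_simps)
    finally show ?thesis .
  qed
  have d: "(\<lambda>n. ?d n / measure L (F n)) \<longlonglongrightarrow> 0"
  proof (rule LIMSEQ_I)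
    fix e :: real assume "0 < e"
    then have "\<forall>\<^sub>F n in sequentially. ?d n \<le> e / 2 * measure L (F n)"
      by (intro boundary_small) simp
    with eventually_F_pos have "\<forall>\<^sub>F n in sequentially. norm (?d n / measure L (F n) - 0) < e"
    proof eventually_elim
      case (elim n)
      have "e / 2 * measure L (F n) < e * measure L (F n)"
        using elim(1) \<open>0 < e\<close> by simp
      with elim(2) have "?d n < e * measure L (F n)" by (rule le_less_trans)
      then show ?case using elim(1) by (simp add: field_simps)
    qed
    then show "\<exists>no. \<forall>n\<ge>no. norm (?d n / measure L (F n) - 0) < e"
      by (simp add: eventually_sequentially)
  qed
  have "(\<lambda>n. ?d n / measure L (F n) * (LINT x|M. \<bar>f x\<bar>)) \<longlonglongrightarrow> 0 * (LINT x|M. \<bar>f x\<bar>)"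
    by (intro tendsto_intros d)
  then have lim: "(\<lambda>n. ?d n * (LINT x|M. \<bar>f x\<bar>) / measure L (F n)) \<longlonglongrightarrow> 0"
    by simp
  show "(\<lambda>n. (LINT x|M. \<bar>orbit_integral (F n) ?w x\<bar>) / measure L (F n)) \<longlonglongrightarrow> 0"
    by (rule tendsto_sandwich[OF _ _ tendsto_const lim])
       (auto intro!: always_eventually divide_right_mono le)
qed

section \<open>Invariant functions and conditional expectations\<close>

abbreviation "\<I> \<equiv> Inv_algebra act M"

lemma subalgebra_Inv: "subalgebra M \<I>"
proof -
  have "space \<I> = space M" by (simp add: Inv_algebra_def space_measure_of_conv)
  then show ?thesis using sets_Inv_algebra[OF G_space] by (auto simp: subalgebra_def)
qed

sublocale Inv: finite_measure_subalgebra M \<I>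
  by unfold_locales (rule subalgebra_Inv)

lemma Inv_measurableI:
  fixes \<psi> :: "'x \<Rightarrow> real"
  assumes [measurable]: "\<psi> \<in> borel_measurable M"
    and inv: "\<And>g x. x \<in> space M \<Longrightarrow> \<psi> (act g x) = \<psi> x"
  shows "\<psi> \<in> borel_measurable \<I>"
proof (rule measurableI)
  fix B :: "real set" assume [measurable]: "B \<in> sets borel"
  let ?A = "\<psi> -` B \<inter> space M"
  have "act g ` ?A = ?A" for g
  proof (intro set_eqI iffI)
    fix x assume x: "x \<in> ?A"
    then show "x \<in> act g ` ?A"
      by (intro image_eqI[of _ _ "act (- g) x"]) (auto simp: act_act inv)
  qed (auto simp: inv)
  then show "\<psi> -` B \<inter> space \<I> \<in> sets \<I>"
    using subalgebra_Inv by (auto simp: sets_Inv_algebra[OF G_space] subalgebra_def)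
qed simp

text \<open>Level sets of \<open>\<psi>\<close> belong to \<open>\<I>\<close> and are strictly
  invariant, so no null set has to be excluded.\<close>

lemma Inv_invariant:
  fixes \<psi> :: "'x \<Rightarrow> real"
  assumes "\<psi> \<in> borel_measurable \<I>" and x: "x \<in> space M"
  shows "\<psi> (act g x) = \<psi> x"
proof -
  let ?A = "\<psi> -` {\<psi> x} \<inter> space M"
  have "\<psi> -` {\<psi> x} \<inter> space \<I> \<in> sets \<I>"
    using assms(1) by (rule measurable_sets) simp
  then have "act g ` ?A = ?A"
    using subalgebra_Inv by (auto simp: sets_Inv_algebra[OF G_space] subalgebra_def)
  moreover have "act g x \<in> act g ` ?A" using x by blast
  ultimately show ?thesis by blast
qed

lemma Inv_set_act:
  assumes "A \<in> sets \<I>" "x \<in> space M"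
  shows "act g x \<in> A \<longleftrightarrow> x \<in> A"
proof -
  have A: "act h ` A = A" for h using assms(1) by (simp add: sets_Inv_algebra[OF G_space])
  show ?thesis
  proof
    assume "act g x \<in> A"
    then have "act (- g) (act g x) \<in> A" using A[of "- g"] by blast
    then show "x \<in> A" using assms(2) by (simp add: act_act)
  qed (use A[of g] in blast)
qed

text \<open>On the set of points whose orbit map is almost everywhere constant,
  \<open>\<psi>'\<close> is that constant, recovered as an average over a fixed \<open>F n\<close>.\<close>

lemma invariant_version:
  fixes \<psi> :: "'x \<Rightarrow> real"
  assumes [measurable]: "\<psi> \<in> borel_measurable M"
    and inv: "\<And>g. AE x in M. \<psi> (act g x) = \<psi> x"
  obtains \<psi>' where "\<psi>' \<in> borel_measurable \<I>" "AE x in M. \<psi>' x = \<psi> x"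
proof -
  obtain n where n: "0 < measure L (F n)"
    using eventually_F_pos by (auto simp: eventually_sequentially)
  define c where "c = (\<lambda>x. (LINT g:F n|L. \<psi> (act g x)) / measure L (F n))"
  have [measurable]: "c \<in> borel_measurable M"
    unfolding c_def set_lebesgue_integral_def by measurable
  have c: "c x = a" if x: "x \<in> space M" and "AE g in L. \<psi> (act g x) = a" for x a
  proof -
    have [measurable]: "(\<lambda>g. x) \<in> measurable N M" for N using x by simp
    have "(LINT g:F n|L. \<psi> (act g x)) = (LINT g:F n|L. a)"
      unfolding set_lebesgue_integral_def using that(2) by (intro integral_cong_AE) auto
    also have "\<dots> = measure L (F n) * a"
      using emeasure_F[of n] by (simp add: set_lebesgue_integral_def)
    finally show ?thesis using n by (simp add: c_def)
  qed
  define E where "E = {x \<in> space M. AE g in L. \<psi> (act g x) = c x}"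
  have E_iff: "x \<in> E \<longleftrightarrow> emeasure L {g. \<psi> (act g x) \<noteq> c x} = 0" if x: "x \<in> space M" for x
  proof -
    have [measurable]: "(\<lambda>g. x) \<in> measurable N M" for N using x by simp
    have "{g \<in> space L. \<psi> (act g x) \<noteq> c x} \<in> sets L" by measurable
    from AE_iff_measurable[OF this refl] show ?thesis using x by (simp add: E_def)
  qed
  \<comment> \<open>For measurability of \<open>E\<close>: the measure of a section depends
    measurably on \<open>x\<close>, and \<open>E\<close> is where it vanishes.\<close>
  have "(\<lambda>x. emeasure L (Pair x -` {p \<in> space (M \<Otimes>\<^sub>M L). \<psi> (act (snd p) (fst p)) \<noteq> c (fst p)})) \<in> borel_measurable M"
    using LM.pair_sigma_finite_axioms unfolding pair_sigma_finite_def
    by (intro sigma_finite_measure.measurable_emeasure_Pair) (simp, measurable)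
  then have "{x \<in> space M. emeasure L (Pair x -` {p \<in> space (M \<Otimes>\<^sub>M L). \<psi> (act (snd p) (fst p)) \<noteq> c (fst p)}) = 0} \<in> sets M"
    by measurable
  also have "{x \<in> space M. emeasure L (Pair x -` {p \<in> space (M \<Otimes>\<^sub>M L). \<psi> (act (snd p) (fst p)) \<noteq> c (fst p)}) = 0} = E"
    using E_iff by (auto simp: space_pair_measure E_def)
  finally have [measurable]: "E \<in> sets M" .
  have E_act: "act h x \<in> E \<and> c (act h x) = c x" if "x \<in> E" for h x
  proof -
    have x: "x \<in> space M" and ae: "AE g in L. \<psi> (act g x) = c x" using that by (auto simp: E_def)
    have [measurable]: "(\<lambda>g. x) \<in> measurable N M" for N using x by simp
    \<comment> \<open>The orbit map of \<open>act h x\<close> is that of \<open>x\<close> after a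
      right translation, which preserves null sets.\<close>
    have "AE g in L. \<psi> (act (g + h) x) = c x"
      by (rule AE_right[OF _ ae]) measurable
    then have ae': "AE g in L. \<psi> (act g (act h x)) = c x"
      using x by (simp add: act_act)
    with x c[of "act h x" "c x"] show ?thesis by (simp add: E_def)
  qed
  \<comment> \<open>Since \<open>E\<close> and \<open>c\<close> on \<open>E\<close> are strictly
    invariant, the default 0 off \<open>E\<close> keeps \<open>\<psi>'\<close> strictly
    invariant.\<close>
  define \<psi>' where "\<psi>' = (\<lambda>x. if x \<in> E then c x else 0)"
  show thesis
  proof
    show "\<psi>' \<in> borel_measurable \<I>"
    proof (rule Inv_measurableI)
      show "\<psi>' \<in> borel_measurable M" unfolding \<psi>'_def by measurable
      fix g x assume x: "x \<in> space M"
      have "act g x \<in> E \<longleftrightarrow> x \<in> E"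
        using E_act[of x g] E_act[of "act g x" "- g"] x by (auto simp: act_act)
      then show "\<psi>' (act g x) = \<psi>' x" using E_act[of x g] by (simp add: \<psi>'_def)
    qed
    \<comment> \<open>The null sets for uncountably many \<open>g\<close> cannot be united; Fubini
      trades every \<open>g\<close> for almost every \<open>g\<close>.\<close>
    have "AE g in L. AE x in M. \<psi> (act g x) = \<psi> x" using inv by simp
    then have "AE x in M. AE g in L. \<psi> (act g x) = \<psi> x"
      by (subst LM.AE_commute[symmetric]) measurable
    with AE_space show "AE x in M. \<psi>' x = \<psi> x"
    proof eventually_elim
      case (elim x)
      then have "c x = \<psi> x" by (intro c)
      then show ?case using elim by (simp add: \<psi>'_def E_def)
    qed
  qed
qed

text \<open>Boundedness is what \<open>L2_projection\<close> requires, vanishing averages are what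
  passes to the limit, and vanishing integrals over invariant sets identify the remainder of the
  projection as a conditional expectation.\<close>

definition vanishing_test :: "('x \<Rightarrow> real) set" where
  "vanishing_test = {w \<in> borel_measurable M. (\<exists>C. \<forall>x\<in>space M. \<bar>w x\<bar> \<le> C) \<and> averages_vanish w \<and>
      (\<forall>A\<in>sets \<I>. (LINT x|M. indicator A x * w x) = 0)}"

lemma sets_Inv_M: "A \<in> sets \<I> \<Longrightarrow> A \<in> sets M"
  using subalgebra_Inv by (auto simp: subalgebra_def)

lemma vanishing_test_lincomb:
  assumes w: "w \<in> vanishing_test" and v: "v \<in> vanishing_test"
  shows "(\<lambda>x. w x + a * v x) \<in> vanishing_test"
proof -
  obtain C C' where "\<forall>x\<in>space M. \<bar>w x\<bar> \<le> C" "\<forall>x\<in>space M. \<bar>v x\<bar> \<le> C'"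
    using w v by (auto simp: vanishing_test_def)
  then have "\<bar>w x + a * v x\<bar> \<le> C + \<bar>a\<bar> * C'" if "x \<in> space M" for x
    using that by (auto simp: abs_mult intro!: order_trans[OF abs_triangle_ineq] add_mono mult_left_mono)
  moreover have "averages_vanish (\<lambda>x. w x + a * v x)" using w v by (intro averages_vanish_lincomb) (auto simp: vanishing_test_def)
  moreover have "(LINT x|M. indicator A x * (w x + a * v x)) = 0" if A: "A \<in> sets \<I>" for A
  proof -
    have i: "integrable M (\<lambda>x. indicator A x * w x)" "integrable M (\<lambda>x. indicator A x * v x)"
      using w v A by (auto simp: vanishing_test_def averages_vanish_def intro!: integrable_indicator_mult sets_Inv_M)
    have "(LINT x|M. indicator A x * (w x + a * v x))
        = (LINT x|M. indicator A x * w x + a * (indicator A x * v x))"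
      by (simp add: algebra_simps)
    also have "\<dots> = 0" using w v A i by (simp add: vanishing_test_def)
    finally show ?thesis .
  qed
  ultimately show ?thesis using w v by (auto simp: vanishing_test_def)
qed

section \<open>Bounded coboundaries as test functions\<close>

lemma D_inverse: "D (- k) (act k x) * D k x = 1" if x: "x \<in> space M"
proof -
  have "D 0 x = D 0 x * D 0 x" using D_add[OF x, of 0 0] x by simp
  then have "D 0 x = 1" using D_pos[OF x, of 0] by simp
  then show ?thesis using D_add[OF x, of "- k" k] by simp
qed

text \<open>The bound by \<open>D (- k)\<close> keeps \<open>T\<^sub>k \<phi>\<close> bounded, by
  \<open>D_inverse\<close>. Integrals over an invariant set cancel because its indicator commutes
  with \<open>T\<^sub>k\<close>.\<close>

lemma vanishing_test_coboundary:
  assumes [measurable]: "\<phi> \<in> borel_measurable M"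
    and bound: "\<And>x. x \<in> space M \<Longrightarrow> \<bar>\<phi> x\<bar> \<le> min 1 (D (- k) x)"
  shows "(\<lambda>x. D k x * \<phi> (act k x) - \<phi> x) \<in> vanishing_test"
proof -
  have i: "integrable M \<phi>"
    by (rule integrable_const_bound[of _ 1]) (use bound in \<open>auto intro!: AE_I2\<close>)
  have "\<bar>D k x * \<phi> (act k x) - \<phi> x\<bar> \<le> 1 + 1" if x: "x \<in> space M" for x
  proof -
    have "\<bar>D k x * \<phi> (act k x)\<bar> \<le> D k x * D (- k) (act k x)"
      using bound[of "act k x"] x D_nonneg[OF x, of k] by (auto simp: abs_mult intro!: mult_left_mono)
    then have "\<bar>D k x * \<phi> (act k x)\<bar> \<le> 1" using D_inverse[OF x, of k] by (simp add: mult.commute)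
    moreover have "\<bar>\<phi> x\<bar> \<le> 1" using bound[OF x] by simp
    ultimately show ?thesis by linarith
  qed
  moreover have "(LINT x|M. indicator A x * (D k x * \<phi> (act k x) - \<phi> x)) = 0" if A: "A \<in> sets \<I>" for A
  proof -
    have iA: "integrable M (\<lambda>x. indicator A x * \<phi> x)"
      by (intro integrable_indicator_mult sets_Inv_M A i)
    have "(LINT x|M. indicator A x * (D k x * \<phi> (act k x) - \<phi> x))
      = (LINT x|M. D k x * (indicator A (act k x) * \<phi> (act k x)) - indicator A x * \<phi> x)"
      using Inv_set_act[OF A] by (intro Bochner_Integration.integral_cong) (auto simp: algebra_simps indicator_def)
    also have "\<dots> = 0"
      using iA integrable_translate[OF iA, of k] integral_translate[OF iA, of k] by simp
    finally show ?thesis .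
  qed
  ultimately show ?thesis
    using averages_vanish_coboundary[OF i, of k] by (auto simp: vanishing_test_def)
qed

text \<open>Testing against the coboundary of \<open>sgn (\<psi> \<circ> act j - \<psi>) * min 1 (D j)\<close>; the second factor
  keeps this coboundary bounded.\<close>

lemma orthogonal_imp_invariant:
  assumes psi: "integrable M \<psi>" and orth: "\<And>w. w \<in> vanishing_test \<Longrightarrow> (LINT x|M. \<psi> x * w x) = 0"
  shows "AE x in M. \<psi> (act j x) = \<psi> x"
proof -
  have [measurable]: "\<psi> \<in> borel_measurable M" using psi by auto
  define \<phi> where "\<phi> = (\<lambda>y. sgn (\<psi> (act j y) - \<psi> y) * min 1 (D j y))"
  \<comment> \<open>Substituting along \<open>act (- j)\<close> moves the shift from
    \<open>\<psi>\<close> to \<open>\<phi>\<close>: the integral of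
    \<open>\<psi> (act j x) * \<phi> x\<close> becomes that of \<open>\<psi>\<close> against
    \<open>T\<^sub>k \<phi>\<close>.\<close>
  define k where "k = - j"
  have j: "j = - k" by (simp add: k_def)
  have [measurable]: "\<phi> \<in> borel_measurable M" unfolding \<phi>_def by measurable
  have bound: "\<bar>\<phi> x\<bar> \<le> min 1 (D j x)" if "x \<in> space M" for x
    using D_nonneg[OF that, of j] by (auto simp: \<phi>_def abs_mult sgn_if)
  have "(\<lambda>x. D k x * \<phi> (act k x) - \<phi> x) \<in> vanishing_test"
    using bound by (intro vanishing_test_coboundary) (auto simp: j)
  then have 0: "(LINT x|M. \<psi> x * (D k x * \<phi> (act k x) - \<phi> x)) = 0" by (rule orth)
  \<comment> \<open>\<open>\<psi> (act j x)\<close> alone need not be integrable, but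
    \<open>D j x * \<psi> (act j x)\<close> is; here the factor \<open>min 1 (D j)\<close> is needed
    a second time.\<close>
  have i1: "integrable M (\<lambda>x. \<psi> (act j x) * \<phi> x)"
  proof (rule Bochner_Integration.integrable_bound[OF integrable_translate[OF psi, of j]])
    have "\<bar>\<phi> x\<bar> * \<bar>\<psi> (act j x)\<bar> \<le> \<bar>D j x\<bar> * \<bar>\<psi> (act j x)\<bar>" if "x \<in> space M" for x
      using bound[OF that] by (intro mult_right_mono) auto
    then show "AE x in M. norm (\<psi> (act j x) * \<phi> x) \<le> norm (D j x * \<psi> (act j x))"
      by (auto simp: abs_mult mult.commute)
  qed measurable
  have i2: "integrable M (\<lambda>x. \<psi> x * \<phi> x)"
  proof (rule Bochner_Integration.integrable_bound[OF psi])
    have "\<bar>\<psi> x\<bar> * \<bar>\<phi> x\<bar> \<le> \<bar>\<psi> x\<bar> * 1" if "x \<in> space M" for x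
      using bound[OF that] by (intro mult_left_mono) auto
    then show "AE x in M. norm (\<psi> x * \<phi> x) \<le> norm (\<psi> x)"
      by (auto simp: abs_mult)
  qed measurable
  have eq: "D k x * (\<psi> (act j (act k x)) * \<phi> (act k x)) = \<psi> x * (D k x * \<phi> (act k x))" if "x \<in> space M" for x
    using that by (simp add: j act_act)
  have i3: "integrable M (\<lambda>x. \<psi> x * (D k x * \<phi> (act k x)))"
    using integrable_translate[OF i1, of k] by (subst (asm) Bochner_Integration.integrable_cong[OF refl eq]) auto
  have "(LINT x|M. \<psi> x * (D k x * \<phi> (act k x))) = (LINT x|M. \<psi> (act j x) * \<phi> x)"
    unfolding integral_translate[OF i1, of k, symmetric]
    by (intro Bochner_Integration.integral_cong refl eq[symmetric])
  with 0 i1 i2 i3 have "(LINT x|M. (\<psi> (act j x) - \<psi> x) * \<phi> x) = 0"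
    by (simp add: algebra_simps)
  moreover have "(\<psi> (act j x) - \<psi> x) * \<phi> x = \<bar>\<psi> (act j x) - \<psi> x\<bar> * min 1 (D j x)" for x
    unfolding \<phi>_def by (simp add: abs_sgn mult_ac)
  ultimately have "(LINT x|M. \<bar>\<psi> (act j x) - \<psi> x\<bar> * min 1 (D j x)) = 0" by simp
  moreover have "integrable M (\<lambda>x. \<bar>\<psi> (act j x) - \<psi> x\<bar> * min 1 (D j x))"
    using Bochner_Integration.integrable_diff[OF i1 i2]
    by (simp add: \<phi>_def abs_sgn algebra_simps)
  ultimately have "AE x in M. \<bar>\<psi> (act j x) - \<psi> x\<bar> * min 1 (D j x) = 0"
    by (subst (asm) integral_nonneg_eq_0_iff_AE) (auto intro!: AE_I2 mult_nonneg_nonneg simp: D_nonneg)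
  with AE_space show ?thesis
  proof eventually_elim
    case (elim x)
    then show ?case using D_pos[of x j] by auto
  qed
qed

section \<open>Vanishing averages of centered functions\<close>

lemma L1_real_cond_exp:
  assumes "integrable M u"
  shows "(LINT x|M. \<bar>real_cond_exp M \<I> u x\<bar>) \<le> (LINT x|M. \<bar>u x\<bar>)"
proof -
  have [measurable]: "u \<in> borel_measurable M" using assms by auto
  have "(\<integral>\<^sup>+x. ennreal \<bar>real_cond_exp M \<I> u x\<bar> \<partial>M) \<le> (\<integral>\<^sup>+x. 1 * nn_cond_exp M \<I> (\<lambda>x. ennreal \<bar>u x\<bar>) x \<partial>M)"
    using Inv.real_cond_exp_abs[of u] by (intro nn_integral_mono_AE) auto
  also have "\<dots> = (\<integral>\<^sup>+x. 1 * ennreal \<bar>u x\<bar> \<partial>M)"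
    by (intro Inv.nn_cond_exp_intg) auto
  finally show ?thesis
    by (simp add: nn_integral_abs_finite assms Inv.real_cond_exp_int)
qed

text \<open>The remainder \<open>\<psi>\<close> of the projection along
  \<open>vanishing_test\<close> has an invariant version and the same integrals as \<open>f\<close>
  over invariant sets, so it is the conditional expectation. Thus the centered function is an
  \<open>L\<^sup>1\<close>-limit of the projections \<open>w n\<close>.\<close>

lemma averages_vanish_centered_bounded:
  assumes f [measurable]: "f \<in> borel_measurable M" and b: "\<exists>C. \<forall>x\<in>space M. \<bar>f x\<bar> \<le> C"
  shows "averages_vanish (\<lambda>x. f x - real_cond_exp M \<I> f x)"
proof -
  have if': "integrable M f"
    using b by (metis AE_I2 f integrable_const_bound real_norm_def)
  have W0: "(\<lambda>x. 0) \<in> vanishing_test" by (auto simp: vanishing_test_def averages_vanish_def orbit_integral_def)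
  obtain w \<psi> where w: "\<And>n. w n \<in> vanishing_test" and psi: "integrable M \<psi>"
    and lim: "(\<lambda>n. expectation (\<lambda>x. \<bar>f x - w n x - \<psi> x\<bar>)) \<longlonglongrightarrow> 0"
    and orth: "\<And>v. v \<in> vanishing_test \<Longrightarrow> expectation (\<lambda>x. \<psi> x * v x) = 0"
  proof (rule L2_projection[of vanishing_test f])
    show "w \<in> borel_measurable M" "\<exists>C. \<forall>x\<in>space M. \<bar>w x\<bar> \<le> C" if "w \<in> vanishing_test" for w
      using that by (auto simp: vanishing_test_def)
    show "(\<lambda>x. w x + a * v x) \<in> vanishing_test" if "w \<in> vanishing_test" "v \<in> vanishing_test" for w v a
      using that by (rule vanishing_test_lincomb)
    show "vanishing_test \<noteq> {}" using W0 by blast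
  qed (use f b in blast)+
  have iw: "integrable M (w n)" for n using w[of n] by (simp add: vanishing_test_def averages_vanish_def)
  obtain \<psi>' where p': "\<psi>' \<in> borel_measurable \<I>" and eq: "AE x in M. \<psi>' x = \<psi> x"
    using invariant_version[of \<psi>] orthogonal_imp_invariant[OF psi orth] psi by blast
  have p'M [measurable]: "\<psi>' \<in> borel_measurable M"
    by (rule measurable_from_subalg[OF subalgebra_Inv p'])
  have ip': "integrable M \<psi>'"
    using psi eq by (subst integrable_cong_AE[of _ _ \<psi>]) auto
  have "AE x in M. real_cond_exp M \<I> f x = \<psi>' x"
  proof (rule Inv.real_cond_exp_charact)
    fix A assume A: "A \<in> sets \<I>"
    have AM [measurable]: "A \<in> sets M" by (rule sets_Inv_M[OF A])
    have le: "\<bar>(LINT x|M. indicator A x * f x) - (LINT x|M. indicator A x * \<psi> x)\<bar>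
        \<le> expectation (\<lambda>x. \<bar>f x - w n x - \<psi> x\<bar>)" for n
    proof -
      have "(LINT x|M. indicator A x * w n x) = 0" using w[of n] A by (simp add: vanishing_test_def)
      then have "(LINT x|M. indicator A x * f x) - (LINT x|M. indicator A x * \<psi> x)
          = (LINT x|M. indicator A x * (f x - w n x - \<psi> x))"
        using if' iw[of n] psi by (simp add: right_diff_distrib integrable_indicator_mult AM)
      also have "\<bar>\<dots>\<bar> \<le> (LINT x|M. \<bar>indicator A x * (f x - w n x - \<psi> x)\<bar>)"
        by (rule integral_abs_bound)
      also have "\<dots> \<le> expectation (\<lambda>x. \<bar>f x - w n x - \<psi> x\<bar>)"
        using if' iw[of n] psi
        by (intro integral_mono) (auto intro!: integrable_abs integrable_indicator_mult AM split: split_indicator)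
      finally show ?thesis .
    qed
    have "(LINT x|M. indicator A x * f x) = (LINT x|M. indicator A x * \<psi> x)"
      using LIMSEQ_le_const[OF lim] le by force
    also have "\<dots> = (LINT x|M. indicator A x * \<psi>' x)"
      using eq psi by (intro integral_cong_AE) auto
    finally show "(LINT x:A|M. f x) = (LINT x:A|M. \<psi>' x)"
      by (simp add: set_lebesgue_integral_def)
  qed (use if' ip' p' in auto)
  with eq have ae: "AE x in M. real_cond_exp M \<I> f x = \<psi> x" by eventually_elim simp
  show ?thesis
  proof (rule averages_vanish_limit)
    show "integrable M (\<lambda>x. f x - real_cond_exp M \<I> f x)"
      using if' Inv.real_cond_exp_int(1)[OF if'] by simp
    fix e :: real assume "0 < e"
    then have "\<forall>\<^sub>F n in sequentially. expectation (\<lambda>x. \<bar>f x - w n x - \<psi> x\<bar>) < e"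
      using lim by (intro order_tendstoD)
    then obtain n where n: "expectation (\<lambda>x. \<bar>f x - w n x - \<psi> x\<bar>) < e"
      by (auto simp: eventually_sequentially)
    have "(LINT x|M. \<bar>f x - real_cond_exp M \<I> f x - w n x\<bar>) = expectation (\<lambda>x. \<bar>f x - w n x - \<psi> x\<bar>)"
      using ae iw[of n] psi by (intro integral_cong_AE) (auto elim!: eventually_mono simp: algebra_simps)
    with n w[of n] show "\<exists>h. averages_vanish h \<and> (LINT x|M. \<bar>f x - real_cond_exp M \<I> f x - h x\<bar>) \<le> e"
      by (intro exI[of _ "w n"]) (auto simp: vanishing_test_def)
  qed
qed

text \<open>Truncation reduces to bounded functions. Conditional expectation contracts the
  \<open>L\<^sup>1\<close>-norm, so centering at most doubles the truncation error, hence
  \<open>e / 2\<close>.\<close>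

lemma averages_vanish_centered:
  assumes f: "integrable M f"
  shows "averages_vanish (\<lambda>x. f x - real_cond_exp M \<I> f x)"
proof (rule averages_vanish_limit)
  have [measurable]: "f \<in> borel_measurable M" using f by auto
  show "integrable M (\<lambda>x. f x - real_cond_exp M \<I> f x)"
    using f Inv.real_cond_exp_int(1)[OF f] by simp
  fix e :: real assume e: "0 < e"
  define t where "t n = (\<lambda>x. max (- real n) (min (real n) (f x)))" for n
  have [measurable]: "t n \<in> borel_measurable M" for n unfolding t_def by measurable
  have bt: "\<bar>t n x\<bar> \<le> real n" "\<bar>t n x\<bar> \<le> \<bar>f x\<bar>" for n x by (auto simp: t_def)
  have it: "integrable M (t n)" for n
    by (rule Bochner_Integration.integrable_bound[OF f]) (auto simp: bt)
  have "(\<lambda>n. LINT x|M. \<bar>f x - t n x\<bar>) \<longlonglongrightarrow> (LINT x|M. 0)"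
  proof (rule integral_dominated_convergence)
    show "integrable M (\<lambda>x. 2 * \<bar>f x\<bar>)" using f by simp
    show "AE x in M. (\<lambda>n. \<bar>f x - t n x\<bar>) \<longlonglongrightarrow> 0"
    proof (rule AE_I2)
      fix x
      obtain N where "\<bar>f x\<bar> \<le> real N" using real_arch_simple by blast
      then have "\<bar>f x - t n x\<bar> = 0" if "N \<le> n" for n using that by (auto simp: t_def)
      then show "(\<lambda>n. \<bar>f x - t n x\<bar>) \<longlonglongrightarrow> 0"
        by (intro tendsto_eventually) (auto simp: eventually_sequentially)
    qed
    show "AE x in M. norm \<bar>f x - t n x\<bar> \<le> 2 * \<bar>f x\<bar>" for n
      using bt(2)[of n] by (intro AE_I2) (smt (verit, best) real_norm_def)
  qed measurable
  then have "\<forall>\<^sub>F n in sequentially. (LINT x|M. \<bar>f x - t n x\<bar>) < e / 2"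
    using e by (intro order_tendstoD) auto
  then obtain n where n: "(LINT x|M. \<bar>f x - t n x\<bar>) < e / 2"
    by (auto simp: eventually_sequentially)
  let ?E = "real_cond_exp M \<I>"
  have id: "integrable M (\<lambda>x. f x - t n x)" using f it by simp
  have "(LINT x|M. \<bar>f x - ?E f x - (t n x - ?E (t n) x)\<bar>)
      \<le> (LINT x|M. \<bar>f x - t n x\<bar> + \<bar>?E (\<lambda>x. f x - t n x) x\<bar>)"
  proof (rule integral_mono_AE)
    show "AE x in M. \<bar>f x - ?E f x - (t n x - ?E (t n) x)\<bar> \<le> \<bar>f x - t n x\<bar> + \<bar>?E (\<lambda>x. f x - t n x) x\<bar>"
      using Inv.real_cond_exp_diff[OF f it[of n]] by eventually_elim simp
  qed (use f it[of n] id in \<open>auto simp: Inv.real_cond_exp_int\<close>)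
  also have "\<dots> = (LINT x|M. \<bar>f x - t n x\<bar>) + (LINT x|M. \<bar>?E (\<lambda>x. f x - t n x) x\<bar>)"
    using id by (subst Bochner_Integration.integral_add) (auto simp: Inv.real_cond_exp_int)
  also have "\<dots> \<le> e"
    using n L1_real_cond_exp[OF id] by simp
  finally have "(LINT x|M. \<bar>f x - ?E f x - (t n x - ?E (t n) x)\<bar>) \<le> e" .
  moreover have "averages_vanish (\<lambda>x. t n x - ?E (t n) x)"
    by (intro averages_vanish_centered_bounded) (use bt(1) in auto)
  ultimately show "\<exists>h. averages_vanish h \<and> (LINT x|M. \<bar>f x - ?E f x - h x\<bar>) \<le> e" by blast
qed

section \<open>Choosing translates\<close>

lemma ratio_average_eq: "ratio_average L act D B f x = orbit_integral B f x / orbit_integral B (\<lambda>_. 1) x"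
  by (simp add: ratio_average_def orbit_integral_def)

lemma ratio_average_measurable [measurable]:
  assumes [measurable]: "B \<in> sets borel" "f \<in> borel_measurable M"
  shows "ratio_average L act D B f \<in> borel_measurable M"
  unfolding ratio_average_eq[abs_def] by measurable

lemma ratio_average_translate:
  assumes [measurable]: "B \<in> sets borel" "f \<in> borel_measurable M" and x: "x \<in> space M"
  shows "ratio_average L act D ((\<lambda>g. g - h) ` B) f x = ratio_average L act D B f (act (- h) x)"
proof -
  obtain c where c: "0 < c" and tr: "\<And>A u. A \<in> sets borel \<Longrightarrow> u \<in> borel_measurable borel \<Longrightarrow>
      (LINT g:((\<lambda>g. g - h) ` A)|L. u g) = c * (LINT g:A|L. u (g - h) :: real)"
    by (rule right_translate_scaling) blast
  have [measurable]: "(\<lambda>g. x) \<in> measurable N M" for N using x by simp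
  have "orbit_integral ((\<lambda>g. g - h) ` B) u x = (c * D (- h) x) * orbit_integral B u (act (- h) x)"
    if [measurable]: "u \<in> borel_measurable M" for u
  proof -
    have "orbit_integral ((\<lambda>g. g - h) ` B) u x = c * (LINT g:B|L. D (g + - h) x * u (act (g + - h) x))"
      unfolding orbit_integral_def by (subst tr) auto
    also have "\<dots> = c * (LINT g:B|L. D (- h) x * (D g (act (- h) x) * u (act g (act (- h) x))))"
      using x unfolding D_add[OF x] act_act[OF x, symmetric] by (simp add: mult_ac)
    finally show ?thesis by (simp add: orbit_integral_def)
  qed
  then show ?thesis using c D_pos[OF x, of "- h"] by (simp add: ratio_average_eq)
qed

text \<open>\<open>D\<close> is positive and \<open>B\<close> is not null, so the denominator of the
  ratio average is nonzero; the second conjunct records that it is finite. Quotients by 0 and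
  divergent integrals would both silently be 0.\<close>

lemma AE_weight_pos:
  assumes B: "B \<in> fmeasurable L" and pos: "0 < measure L B"
  shows "AE x in M. 0 < orbit_integral B (\<lambda>_. 1) x \<and>
    (\<integral>\<^sup>+g. indicator B g * ennreal (D g x) \<partial>L) = ennreal (orbit_integral B (\<lambda>_. 1) x)"
  using AE_space AE_set_integrable[of "\<lambda>_. 1", OF _ B, simplified]
proof eventually_elim
  case (elim x)
  have [measurable]: "B \<in> sets borel" using B by auto
  have [measurable]: "(\<lambda>g. x) \<in> measurable N M" for N using elim(1) by simp
  have i: "integrable L (\<lambda>g. indicator B g * D g x)" using elim by (simp add: set_integrable_def)
  have nn: "AE g in L. 0 \<le> indicator B g * D g x" using D_nonneg[OF elim(1)] by simp
  have orbit_integral: "orbit_integral B (\<lambda>_. 1) x = (LINT g|L. indicator B g * D g x)"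
    by (simp add: orbit_integral_def set_lebesgue_integral_def)
  have "orbit_integral B (\<lambda>_. 1) x \<noteq> 0"
  proof
    assume "orbit_integral B (\<lambda>_. 1) x = 0"
    then have "AE g in L. indicator B g * D g x = 0"
      unfolding orbit_integral integral_nonneg_eq_0_iff_AE[OF i nn] .
    then have "AE g in L. g \<notin> B"
      by eventually_elim (use D_pos[OF elim(1)] in \<open>auto simp: indicator_def less_le split: if_splits\<close>)
    then have "B \<in> null_sets L" by (simp add: AE_iff_null_sets)
    then show False using pos by (simp add: measure_def null_setsD1)
  qed
  moreover have "0 \<le> orbit_integral B (\<lambda>_. 1) x" unfolding orbit_integral by (rule integral_nonneg_AE[OF nn])
  moreover have "(\<integral>\<^sup>+g. indicator B g * ennreal (D g x) \<partial>L) = ennreal (orbit_integral B (\<lambda>_. 1) x)"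
    unfolding orbit_integral nn_integral_eq_integral[OF i nn, symmetric]
    by (intro nn_integral_cong) (auto split: split_indicator)
  ultimately show ?case by simp
qed

text \<open>By \<open>translate_norm_eq\<close>, the \<open>L\<^sup>1\<close>-norm of the ratio
  average over \<open>B - h\<close>. Moving the point instead of the set makes measurability in
  \<open>h\<close> evident; values in \<open>ennreal\<close> allow for exceptional \<open>h\<close>
  with infinite norm.\<close>

definition translate_norm :: "'g set \<Rightarrow> ('x \<Rightarrow> real) \<Rightarrow> 'g \<Rightarrow> ennreal" where
  "translate_norm B f h = (\<integral>\<^sup>+x. ennreal \<bar>ratio_average L act D B f (act (- h) x)\<bar> \<partial>M)"

lemma translate_norm_measurable [measurable]:
  assumes [measurable]: "B \<in> sets borel" "f \<in> borel_measurable M"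
  shows "translate_norm B f \<in> borel_measurable borel"
  unfolding translate_norm_def by measurable

lemma translate_norm_eq:
  assumes "B \<in> sets borel" "f \<in> borel_measurable M"
  shows "translate_norm B f h = (\<integral>\<^sup>+x. ennreal \<bar>ratio_average L act D ((\<lambda>g. g - h) ` B) f x\<bar> \<partial>M)"
  unfolding translate_norm_def by (intro nn_integral_cong) (simp add: ratio_average_translate[OF assms])

text \<open>Substituting \<open>y = act (- h) x\<close> brings in the factor \<open>D h y\<close>, whose integral over
  \<open>h \<in> B\<close> is exactly the denominator of the ratio average at \<open>y\<close>.\<close>

lemma nn_integral_translate_norm:
  assumes B: "B \<in> fmeasurable L" and pos: "0 < measure L B" and f: "integrable M f"
  shows "(\<integral>\<^sup>+h. indicator B h * translate_norm B f h \<partial>L) = ennreal (LINT x|M. \<bar>orbit_integral B f x\<bar>)"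
proof -
  have [measurable]: "B \<in> sets borel" "f \<in> borel_measurable M" using B f by auto
  let ?a = "ratio_average L act D B f"
  have "(\<integral>\<^sup>+h. indicator B h * translate_norm B f h \<partial>L)
      = (\<integral>\<^sup>+h. \<integral>\<^sup>+y. indicator B h * (ennreal (D h y) * ennreal \<bar>?a y\<bar>) \<partial>M \<partial>L)"
  proof (rule nn_integral_cong)
    fix h
    have "translate_norm B f h = (\<integral>\<^sup>+y. ennreal (D h y) * ennreal \<bar>?a (act (- h) (act h y))\<bar> \<partial>M)"
      unfolding translate_norm_def by (rule nn_integral_translate[symmetric]) measurable
    also have "\<dots> = (\<integral>\<^sup>+y. ennreal (D h y) * ennreal \<bar>?a y\<bar> \<partial>M)"
      by (intro nn_integral_cong) (simp add: act_act)
    finally show "indicator B h * translate_norm B f h = (\<integral>\<^sup>+y. indicator B h * (ennreal (D h y) * ennreal \<bar>?a y\<bar>) \<partial>M)"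
      by (simp add: nn_integral_cmult)
  qed
  also have "\<dots> = (\<integral>\<^sup>+y. \<integral>\<^sup>+h. indicator B h * (ennreal (D h y) * ennreal \<bar>?a y\<bar>) \<partial>L \<partial>M)"
    by (rule LM.Fubini'[symmetric]) measurable
  also have "\<dots> = (\<integral>\<^sup>+y. ennreal \<bar>orbit_integral B f y\<bar> \<partial>M)"
  proof (rule nn_integral_cong_AE)
    show "AE y in M. (\<integral>\<^sup>+h. indicator B h * (ennreal (D h y) * ennreal \<bar>?a y\<bar>) \<partial>L) = ennreal \<bar>orbit_integral B f y\<bar>"
      using AE_space AE_weight_pos[OF B pos]
    proof eventually_elim
      case (elim y)
      have [measurable]: "(\<lambda>g. y) \<in> measurable N M" for N using elim(1) by simp
      have "(\<integral>\<^sup>+h. indicator B h * (ennreal (D h y) * ennreal \<bar>?a y\<bar>) \<partial>L)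
          = (\<integral>\<^sup>+h. indicator B h * ennreal (D h y) \<partial>L) * ennreal \<bar>?a y\<bar>"
        by (subst nn_integral_multc[symmetric]) (auto simp: mult.assoc)
      also have "\<dots> = ennreal (orbit_integral B (\<lambda>_. 1) y * \<bar>?a y\<bar>)"
        using elim by (simp add: ennreal_mult')
      also have "orbit_integral B (\<lambda>_. 1) y * \<bar>?a y\<bar> = \<bar>orbit_integral B f y\<bar>"
        using elim by (simp add: ratio_average_eq abs_divide)
      finally show ?case .
    qed
  qed
  also have "\<dots> = ennreal (LINT x|M. \<bar>orbit_integral B f x\<bar>)"
    by (rule nn_integral_abs_finite[OF orbit_integral_integrable[OF f B]])
  finally show ?thesis .
qed

text \<open>Markov's inequality: the mean over \<open>h \<in> F n\<close> of the summed norms is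
  below \<open>\<delta> / 2\<close>, so some norm reaches \<open>\<delta>\<close> on less than half
  of \<open>F n\<close>, while the \<open>h\<close> whose translate contains \<open>C\<close> fill
  more than half.\<close>

lemma select_translate:
  assumes C: "compact C" and averages_vanish: "\<And>i::nat. averages_vanish (G i)" and \<delta>: "0 < \<delta>"
  obtains n h where "N \<le> n" "0 < measure L (F n)" "C \<subseteq> (\<lambda>g. g - h) ` F n"
    "\<And>i. i \<le> m \<Longrightarrow> translate_norm (F n) (G i) h < ennreal \<delta>" "\<And>i. translate_norm (F n) (G i) h < \<infinity>"
proof -
  have iG: "integrable M (G i)" for i using averages_vanish by (simp add: averages_vanish_def)
  then have [measurable]: "G i \<in> borel_measurable M" for i by auto
  let ?I = "\<lambda>n. \<Sum>i\<le>m. (LINT x|M. \<bar>orbit_integral (F n) (G i) x\<bar>)"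
  have "(\<lambda>n. \<Sum>i\<le>m. (LINT x|M. \<bar>orbit_integral (F n) (G i) x\<bar>) / measure L (F n)) \<longlonglongrightarrow> (\<Sum>i\<le>m. 0)"
    using averages_vanish by (intro tendsto_sum) (simp add: averages_vanish_def)
  then have "(\<lambda>n. ?I n / measure L (F n)) \<longlonglongrightarrow> 0"
    by (simp add: sum_divide_distrib)
  then have "\<forall>\<^sub>F n in sequentially. ?I n / measure L (F n) < \<delta> / 2"
    using \<delta> by (intro order_tendstoD) auto
  moreover have "\<forall>\<^sub>F n in sequentially. invariant_compact L C (1 / 2) (F n)"
    by (rule F_invariant[OF C]) simp
  ultimately have "\<forall>\<^sub>F n in sequentially. N \<le> n \<and> 0 < measure L (F n) \<and>
      ?I n / measure L (F n) < \<delta> / 2 \<and> invariant_compact L C (1 / 2) (F n)"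
    using eventually_F_pos eventually_ge_at_top[of N] by eventually_elim simp
  then obtain n where n: "N \<le> n" "0 < measure L (F n)" "?I n / measure L (F n) < \<delta> / 2"
    "invariant_compact L C (1 / 2) (F n)"
    by (auto simp: eventually_sequentially)
  define P where "P = {h \<in> F n. (\<lambda>k. k + h) ` C \<subseteq> F n}"
  have [measurable]: "P \<in> sets borel" unfolding P_def by (rule invariant_part_sets[OF compact_F])
  have Pfm: "P \<in> fmeasurable L"
    using \<open>P \<in> sets borel\<close> by (intro fmeasurableI2[OF F_fm[of n]]) (auto simp: P_def)
  have half: "measure L (F n) / 2 < measure L P"
    using n(4) by (simp add: invariant_compact_def P_def)
  \<comment> \<open>Countably many \<open>i\<close> cost one null set. The case \<open>i > m\<close>
    is needed too: each ratio average must be integrable at every stage, not only once it is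
    small.\<close>
  have fin: "AE h in L. h \<in> F n \<longrightarrow> translate_norm (F n) (G i) h < \<infinity>" for i
  proof -
    have "AE h in L. indicator (F n) h * translate_norm (F n) (G i) h \<noteq> \<infinity>"
      by (rule nn_integral_PInf_AE) (simp_all add: nn_integral_translate_norm[OF F_fm n(2) iG])
    then show ?thesis by eventually_elim (auto simp: less_top)
  qed
  have "\<exists>h\<in>P. (\<forall>i\<le>m. translate_norm (F n) (G i) h < ennreal \<delta>) \<and> (\<forall>i. translate_norm (F n) (G i) h < \<infinity>)"
  proof (rule ccontr)
    assume neg: "\<not> ?thesis"
    have "AE h in L. \<forall>i. h \<in> F n \<longrightarrow> translate_norm (F n) (G i) h < \<infinity>"
      unfolding AE_all_countable using fin ..
    then have "AE h in L. indicator P h * ennreal \<delta> \<le> (\<Sum>i\<le>m. indicator (F n) h * translate_norm (F n) (G i) h)"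
    proof eventually_elim
      case (elim h)
      show ?case
      proof (cases "h \<in> P")
        case True
        then have hF: "h \<in> F n" by (simp add: P_def)
        with True neg elim obtain i where "i \<le> m" "\<not> translate_norm (F n) (G i) h < ennreal \<delta>"
          by blast
        moreover have "translate_norm (F n) (G i) h \<le> (\<Sum>i\<le>m. translate_norm (F n) (G i) h)"
          using \<open>i \<le> m\<close> by (intro member_le_sum) auto
        ultimately show ?thesis using True hF by (simp add: not_less)
      qed simp
    qed
    then have "(\<integral>\<^sup>+h. indicator P h * ennreal \<delta> \<partial>L) \<le> (\<integral>\<^sup>+h. (\<Sum>i\<le>m. indicator (F n) h * translate_norm (F n) (G i) h) \<partial>L)"
      by (rule nn_integral_mono_AE)
    also have "\<dots> = (\<Sum>i\<le>m. ennreal (LINT x|M. \<bar>orbit_integral (F n) (G i) x\<bar>))"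
      by (subst nn_integral_sum) (simp_all add: nn_integral_translate_norm[OF F_fm n(2) iG])
    also have "\<dots> = ennreal (?I n)" by (rule sum_ennreal) simp
    finally have "ennreal (measure L P * \<delta>) \<le> ennreal (?I n)"
      using \<delta> emeasure_eq_measure2[OF Pfm] by (simp add: nn_integral_multc ennreal_mult')
    then have "measure L P * \<delta> \<le> ?I n"
      by (subst (asm) ennreal_le_iff) (auto intro!: sum_nonneg)
    moreover have "?I n < measure L (F n) / 2 * \<delta>" using n(2,3) by (simp add: field_simps)
    moreover have "measure L (F n) / 2 * \<delta> < measure L P * \<delta>"
      using half \<delta> by (intro mult_strict_right_mono)
    ultimately show False by (meson less_le_trans less_trans less_irrefl)
  qed
  then obtain h where h: "h \<in> P" "\<And>i. i \<le> m \<Longrightarrow> translate_norm (F n) (G i) h < ennreal \<delta>" "\<And>i. translate_norm (F n) (G i) h < \<infinity>"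
    by blast
  have "C \<subseteq> (\<lambda>g. g - h) ` F n"
    unfolding vimage_add_right[symmetric] using h(1) by (auto simp: P_def)
  with n(1,2) h(2,3) that show thesis by blast
qed

text \<open>The conditional expectation is constant along orbits, so it leaves the orbit integral as
  a factor and the denominator cancels.\<close>

lemma ratio_average_decompose:
  assumes B: "B \<in> fmeasurable L" and pos: "0 < measure L B" and f: "integrable M f"
  shows "AE x in M. ratio_average L act D B f x =
    ratio_average L act D B (\<lambda>x. f x - real_cond_exp M \<I> f x) x + real_cond_exp M \<I> f x"
proof -
  let ?E = "real_cond_exp M \<I> f"
  have iE: "integrable M ?E" by (rule Inv.real_cond_exp_int(1)[OF f])
  show ?thesis
    using AE_space AE_weight_pos[OF B pos] orbit_integral_lincomb[OF f iE B, of "- 1"]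
  proof eventually_elim
    case (elim x)
    have "orbit_integral B ?E x = ?E x * orbit_integral B (\<lambda>_. 1) x"
      using Inv_invariant[OF borel_measurable_cond_exp elim(1)] by (simp add: orbit_integral_def mult.commute)
    then show ?case using elim by (simp add: ratio_average_eq field_simps)
  qed
qed

lemma folner_translates:
  assumes averages_vanish: "\<And>i::nat. averages_vanish (G i)"
  obtains S where "folner_sequence L S"
    "\<And>m. S m \<in> fmeasurable L" "\<And>m. 0 < measure L (S m)"
    "\<And>m i. integrable M (ratio_average L act D (S m) (G i))"
    "\<And>m i. i \<le> m \<Longrightarrow> (LINT x|M. \<bar>ratio_average L act D (S m) (G i) x\<bar>) \<le> (1 / 2) ^ m"
proof -
  \<comment> \<open>\<open>m \<le> n\<close> makes the sequence of translates inherit every eventual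
    invariance of \<open>F\<close>. Exhaustion comes from requiring
    \<open>F m \<subseteq> S (Suc m)\<close> in the recursion.\<close>
  define Good where "Good m T \<longleftrightarrow> (\<exists>n h. m \<le> n \<and> 0 < measure L (F n) \<and> T = (\<lambda>g. g - h) ` F n \<and>
    (\<forall>i\<le>m. translate_norm (F n) (G i) h < ennreal ((1 / 2) ^ m)) \<and> (\<forall>i. translate_norm (F n) (G i) h < \<infinity>))" for m T
  have ex: "\<exists>T. Good m T \<and> C \<subseteq> T" if C: "compact C" for m C
    by (rule select_translate[OF C, of G, OF averages_vanish, of "(1 / 2) ^ m" m m]) (auto simp: Good_def)
  have comp: "compact T" if "Good m T" for m T
    using that by (auto simp: Good_def compact_translate compact_F)
  have "\<exists>S. \<forall>m. Good m (S m) \<and> S m \<union> F m \<subseteq> S (Suc m)"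
  proof (rule dependent_nat_choice)
    show "\<exists>T. Good 0 T" using ex[of "{}" 0] by auto
    fix T m assume "Good m T"
    then have "compact (T \<union> F m)" using comp compact_F by blast
    then show "\<exists>T'. Good (Suc m) T' \<and> T \<union> F m \<subseteq> T'" by (rule ex)
  qed
  then obtain S where good: "\<And>m. Good m (S m)" and sub: "\<And>m. S m \<union> F m \<subseteq> S (Suc m)"
    by blast
  have cS: "compact (S m)" for m by (rule comp[OF good])
  have fm: "S m \<in> fmeasurable L" for m
    using emeasure_compact[OF cS] borel_compact[OF cS] by (auto simp: fmeasurable_def)
  have [measurable]: "G i \<in> borel_measurable M" for i using averages_vanish by (auto simp: averages_vanish_def)
  have [measurable]: "S m \<in> sets borel" for m by (rule borel_compact[OF cS])
  show thesis
  proof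
    show "folner_sequence L S"
      unfolding folner_sequence_def
    proof (intro conjI allI impI)
      show "incseq S" using sub by (auto intro: incseq_SucI)
      show "(\<Union>n. S n) = UNIV" using UN_F sub by blast
      fix K :: "'g set" and \<epsilon> :: real assume "compact K \<and> 0 < \<epsilon>"
      then obtain n0 where n0: "\<And>n. n0 \<le> n \<Longrightarrow> invariant_compact L K \<epsilon> (F n)"
        using F_invariant[of K \<epsilon>] by (auto simp: eventually_sequentially)
      have "invariant_compact L K \<epsilon> (S m)" if "n0 \<le> m" for m
        using good[of m] n0 that by (auto simp: Good_def intro!: invariant_compact_translate)
      then show "\<forall>\<^sub>F n in sequentially. invariant_compact L K \<epsilon> (S n)"
        by (auto simp: eventually_sequentially)
    qed (rule cS)
    fix m
    show "S m \<in> fmeasurable L" by (rule fm)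
    obtain n h where nh: "0 < measure L (F n)" "S m = (\<lambda>g. g - h) ` F n"
      "\<And>i. i \<le> m \<Longrightarrow> translate_norm (F n) (G i) h < ennreal ((1 / 2) ^ m)" "\<And>i. translate_norm (F n) (G i) h < \<infinity>"
      using good[of m] by (auto simp: Good_def)
    show "0 < measure L (S m)"
      unfolding nh(2) by (rule right_translate_scaling[of h]) (simp add: nh(1))
    have translate_norm: "translate_norm (F n) (G i) h = (\<integral>\<^sup>+x. ennreal \<bar>ratio_average L act D (S m) (G i) x\<bar> \<partial>M)" for i
      by (simp add: translate_norm_eq nh(2))
    show i: "integrable M (ratio_average L act D (S m) (G i))" for i
      using nh(4)[of i] by (intro integrableI_bounded) (auto simp: translate_norm)
    show "(LINT x|M. \<bar>ratio_average L act D (S m) (G i) x\<bar>) \<le> (1 / 2) ^ m" if "i \<le> m" for i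
      using nh(3)[OF that] unfolding translate_norm nn_integral_abs_finite[OF i] by (simp add: ennreal_less_iff)
  qed
qed

end

theorem corollary1p5:
  fixes L :: "'g::{polish_space,topological_group_add} measure"
    and M :: "'x measure"
    and act :: "'g \<Rightarrow> 'x \<Rightarrow> 'x"
    and D :: "'g \<Rightarrow> 'x \<Rightarrow> real"
    and \<L> :: "('x \<Rightarrow> real) set"
  assumes "locally compact (UNIV :: 'g set)"
    and "left_haar_measure L"
    and "amenable L"
    and "nonsingular_probability_G_space act M"
    and "RN_cocycle act M D"
    and "countable \<L>"
    and "\<forall>f\<in>\<L>. integrable M f"
  shows "\<exists>S. folner_sequence L S \<and>
    (\<forall>f\<in>\<L>.
      (AE x in M. (\<lambda>n. ratio_average L act D (S n) f x)
                    \<longlonglongrightarrow> real_cond_exp M (Inv_algebra act M) f x) \<and>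
      tendsto_L1 M (\<lambda>n. ratio_average L act D (S n) f) (real_cond_exp M (Inv_algebra act M) f))"
proof -
  obtain F where "folner_sequence L F" using assms(3) by (auto simp: amenable_def)
  then interpret nonsingular_action L F M act D
    using assms(2,4,5) by unfold_locales
  \<comment> \<open>Adjoining the zero function makes the family nonempty, so the enumeration has
    range in it even for empty \<open>\<L>\<close>.\<close>
  define f where "f = from_nat_into (insert (\<lambda>_. 0) \<L>)"
  have "range f = insert (\<lambda>_. 0) \<L>"
    unfolding f_def using assms(6) by (intro range_from_nat_into) auto
  then have fi: "integrable M (f i)" and surj: "u \<in> \<L> \<Longrightarrow> \<exists>i. u = f i" for i u
    using assms(7) by (auto, metis insertE integrable_zero rangeI)
  define G where "G i = (\<lambda>x. f i x - real_cond_exp M \<I> (f i) x)" for i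
  have averages_vanish: "averages_vanish (G i)" for i unfolding G_def by (rule averages_vanish_centered[OF fi])
  obtain S where S: "folner_sequence L S" "\<And>m. S m \<in> fmeasurable L" "\<And>m. 0 < measure L (S m)"
    and iG: "\<And>m i. integrable M (ratio_average L act D (S m) (G i))"
    and le: "\<And>m i. i \<le> m \<Longrightarrow> (LINT x|M. \<bar>ratio_average L act D (S m) (G i) x\<bar>) \<le> (1 / 2) ^ m"
    using folner_translates[of G] averages_vanish by blast
  have conv: "(AE x in M. (\<lambda>n. ratio_average L act D (S n) (f i) x) \<longlonglongrightarrow> real_cond_exp M \<I> (f i) x) \<and>
      tendsto_L1 M (\<lambda>n. ratio_average L act D (S n) (f i)) (real_cond_exp M \<I> (f i))" for i
  proof
    let ?E = "real_cond_exp M \<I> (f i)" and ?r = "\<lambda>n. ratio_average L act D (S n)"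
    have [measurable]: "f i \<in> borel_measurable M" using fi by auto
    have iE: "integrable M ?E" by (rule Inv.real_cond_exp_int(1)[OF fi])
    have dec: "AE x in M. ?r n (f i) x = ?r n (G i) x + ?E x" for n
      unfolding G_def by (rule ratio_average_decompose[OF S(2,3) fi])
    have sm: "summable (\<lambda>n. LINT x|M. \<bar>?r n (G i) x\<bar>)"
    proof (rule summable_comparison_test)
      \<comment> \<open>The \<open>i\<close>-th function is controlled only from stage
        \<open>i\<close> on, so \<open>N = i\<close>; the finitely many earlier terms do not affect
        summability.\<close>
      show "\<exists>N. \<forall>n\<ge>N. norm (LINT x|M. \<bar>?r n (G i) x\<bar>) \<le> (1 / 2) ^ n"
        using le[of i] by auto
    qed (simp add: summable_geometric)
    have "AE x in M. \<forall>n. ?r n (f i) x = ?r n (G i) x + ?E x"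
      using dec by (simp add: AE_all_countable)
    moreover have "AE x in M. summable (\<lambda>n. \<bar>?r n (G i) x\<bar>)"
      by (rule AE_summable_integral[OF _ sm]) (rule iG)
    ultimately show "AE x in M. (\<lambda>n. ?r n (f i) x) \<longlonglongrightarrow> ?E x"
    proof eventually_elim
      case (elim x)
      have "(\<lambda>n. ?r n (G i) x) \<longlonglongrightarrow> 0"
        by (rule summable_LIMSEQ_zero[OF summable_rabs_cancel[OF elim(2)]])
      then have "(\<lambda>n. ?r n (G i) x + ?E x) \<longlonglongrightarrow> 0 + ?E x"
        by (intro tendsto_intros)
      then show ?case using elim(1) by simp
    qed
    have [measurable]: "S n \<in> sets borel" for n using S(2)[of n] by auto
    have ir: "integrable M (?r n (f i))" for n
    proof (rule integrable_cong_AE_imp)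
      show "integrable M (\<lambda>x. ?r n (G i) x + ?E x)" using iG iE by simp
      show "AE x in M. ?r n (G i) x + ?E x = ?r n (f i) x" using dec[of n] by eventually_elim simp
    qed measurable
    have "(LINT x|M. \<bar>?r n (f i) x - ?E x\<bar>) = (LINT x|M. \<bar>?r n (G i) x\<bar>)" for n
      using dec[of n] ir[of n] iE iG[of n i] by (intro integral_cong_AE) (auto elim!: eventually_mono)
    then show "tendsto_L1 M (\<lambda>n. ?r n (f i)) ?E"
      using summable_LIMSEQ_zero[OF sm] ir iE by (simp add: tendsto_L1_def)
  qed
  show ?thesis
  proof (intro exI[of _ S] conjI[OF S(1)] ballI)
    fix u assume "u \<in> \<L>"
    then obtain i where "u = f i" using surj by blast
    then show "(AE x in M. (\<lambda>n. ratio_average L act D (S n) u x) \<longlonglongrightarrow> real_cond_exp M \<I> u x) \<and>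
        tendsto_L1 M (\<lambda>n. ratio_average L act D (S n) u) (real_cond_exp M \<I> u)"
      using conv by simp
  qed
qed

end
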